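(* Let $X$ be a nontrivial complex Banach space and let $A(\Omega,X)$ be an $X$-valued function space over a function algebra $A$ on a Hausdorff space $\Omega$. If the base algebra $A$ is infinite dimensional, then $A(\Omega,X)$ has the diameter two property (D2P).
   Context: For a Hausdorff space $\Omega$, $C_b(\Omega)$ is the Banach algebra of bounded complex-valued continuous functions on $\Omega$ with the supremum norm; a function algebra on $\Omega$ is a closed subalgebra of $C_b(\Omega)$ that separates the points of $\Omega$ and contains the constant functions. $C_b(\Omega,X)$ is the Banach space of bounded norm-continuous functions $\Omega\to X$ with the supremum norm. An $X$-valued function space over a function algebra on $\Omega$, denoted $A(\Omega,X)$, is a closed subspace of $C_b(\Omega,X)$ such that (i) the base algebra $A:=\{x^*\circ f: f\in A(\Omega,X),\ x^*\in X^*\}$ is a function algebra on $\Omega$; and (ii) $fg\in A(\Omega,X)$ for every $f\in A$ and $g\in A(\Omega,X)$. A Banach space has the diameter two property (D2P) if every nonempty relatively weakly open subset of its closed unit ball has diameter two. *)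

theory Defs
  imports "HOL-Analysis.Analysis"
begin

section \<open>Complex normed spaces\<close>

text \<open>The library only has real normed spaces. A complex one is a real one whose real scalar
  multiplication is the restriction of a complex scalar multiplication.\<close>

class complex_normed_vector = real_normed_vector +
  fixes scaleC :: "complex \<Rightarrow> 'a \<Rightarrow> 'a"  (infixr "*\<^sub>C" 75)
  assumes scaleC_add_right: "a *\<^sub>C (x + y) = a *\<^sub>C x + a *\<^sub>C y"
    and scaleC_add_left: "(a + b) *\<^sub>C x = a *\<^sub>C x + b *\<^sub>C x"
    and scaleC_scaleC: "a *\<^sub>C b *\<^sub>C x = (a * b) *\<^sub>C x"
    and scaleR_scaleC: "r *\<^sub>R x = complex_of_real r *\<^sub>C x"
    and norm_scaleC: "norm (a *\<^sub>C x) = cmod a * norm x"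

class complex_banach = complex_normed_vector + banach

lemma scaleC_one: "1 *\<^sub>C x = (x :: 'a::complex_normed_vector)"
  using scaleR_scaleC[of 1 x] by simp

interpretation complex_vector:
  vector_space "scaleC :: complex \<Rightarrow> 'a \<Rightarrow> 'a::complex_normed_vector"
  by unfold_locales (simp_all add: scaleC_add_right scaleC_add_left scaleC_scaleC scaleC_one)

lemma bounded_bilinear_scaleC:
  "bounded_bilinear (scaleC :: complex \<Rightarrow> 'a \<Rightarrow> 'a::complex_normed_vector)"
proof
  fix r :: real and a b :: complex and x y :: 'a
  show "(a + b) *\<^sub>C x = a *\<^sub>C x + b *\<^sub>C x" by (rule scaleC_add_left)
  show "a *\<^sub>C (x + y) = a *\<^sub>C x + a *\<^sub>C y" by (rule scaleC_add_right)
  show "(r *\<^sub>R a) *\<^sub>C x = r *\<^sub>R (a *\<^sub>C x)"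
    by (simp add: scaleR_scaleC scaleC_scaleC scaleR_conv_of_real)
  show "a *\<^sub>C (r *\<^sub>R x) = r *\<^sub>R (a *\<^sub>C x)"
    by (simp add: scaleR_scaleC scaleC_scaleC mult.commute)
  show "\<exists>K. \<forall>(a :: complex) (x :: 'a). norm (a *\<^sub>C x) \<le> norm a * norm x * K"
    by (rule exI[of _ 1]) (simp add: norm_scaleC)
qed

instantiation complex :: complex_normed_vector
begin

definition scaleC_complex :: "complex \<Rightarrow> complex \<Rightarrow> complex"
  where "scaleC_complex a x = a * x"

instance
  by standard
    (simp_all add: scaleC_complex_def algebra_simps scaleR_conv_of_real norm_mult)

end

instance complex :: complex_banach ..

section \<open>Products of bounded continuous functions\<close>

text \<open>The pointwise product of a scalar function and a vector-valued function; for two scalar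
  functions it is the multiplication of the algebra of bounded continuous functions, since
  \<open>scaleC\<close> on \<open>complex\<close> is multiplication.\<close>

definition bcontfun_mult ::
    "('w::topological_space \<Rightarrow>\<^sub>C complex) \<Rightarrow> ('w \<Rightarrow>\<^sub>C 'x::complex_normed_vector) \<Rightarrow> ('w \<Rightarrow>\<^sub>C 'x)"
  where "bcontfun_mult f g = Bcontfun (\<lambda>t. apply_bcontfun f t *\<^sub>C apply_bcontfun g t)"

lemma apply_bcontfun_mult [simp]:
  "apply_bcontfun (bcontfun_mult f g) t = apply_bcontfun f t *\<^sub>C apply_bcontfun g t"
proof -
  have "(\<lambda>t. apply_bcontfun f t *\<^sub>C apply_bcontfun g t) \<in> bcontfun"
  proof (rule bcontfun_normI)
    show "continuous_on UNIV (\<lambda>t. apply_bcontfun f t *\<^sub>C apply_bcontfun g t)"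
      by (intro bounded_bilinear.continuous_on[OF bounded_bilinear_scaleC]
          continuous_on_apply_bcontfun)
    show "norm (apply_bcontfun f t *\<^sub>C apply_bcontfun g t) \<le> norm f * norm g" for t
      unfolding norm_scaleC by (intro mult_mono norm_bounded norm_ge_zero)
  qed
  then show ?thesis
    by (simp add: bcontfun_mult_def Bcontfun_inverse)
qed

instantiation bcontfun :: (topological_space, complex_normed_vector) complex_normed_vector
begin

definition scaleC_bcontfun :: "complex \<Rightarrow> ('a \<Rightarrow>\<^sub>C 'b) \<Rightarrow> ('a \<Rightarrow>\<^sub>C 'b)"
  where "scaleC_bcontfun c f = bcontfun_mult (const_bcontfun c) f"

lemma apply_scaleC_bcontfun [simp]:
  "apply_bcontfun (c *\<^sub>C f) t = c *\<^sub>C apply_bcontfun f t" for f :: "'a \<Rightarrow>\<^sub>C 'b"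
  by (simp add: scaleC_bcontfun_def)

instance
proof
  fix a b :: complex and r :: real and f g :: "'a \<Rightarrow>\<^sub>C 'b"
  show "a *\<^sub>C (f + g) = a *\<^sub>C f + a *\<^sub>C g"
    by (rule bcontfun_eqI) (simp add: scaleC_add_right)
  show "(a + b) *\<^sub>C f = a *\<^sub>C f + b *\<^sub>C f"
    by (rule bcontfun_eqI) (simp add: scaleC_add_left)
  show "a *\<^sub>C b *\<^sub>C f = (a * b) *\<^sub>C f"
    by (rule bcontfun_eqI) (simp add: scaleC_scaleC)
  show "r *\<^sub>R f = complex_of_real r *\<^sub>C f"
    by (rule bcontfun_eqI) (simp add: scaleR_scaleC)
  have le: "norm (c *\<^sub>C h) \<le> cmod c * norm h" for c and h :: "'a \<Rightarrow>\<^sub>C 'b"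
    by (rule norm_bound) (simp add: norm_scaleC mult_left_mono norm_bounded)
  show "norm (a *\<^sub>C f) = cmod a * norm f"
  proof (cases "a = 0")
    case True
    then show ?thesis using le[of a f] by simp
  next
    case False
    have "inverse a *\<^sub>C a *\<^sub>C f = f"
      by (rule bcontfun_eqI) (simp add: scaleC_scaleC scaleC_one False)
    then have "norm f \<le> cmod (inverse a) * norm (a *\<^sub>C f)"
      using le[of "inverse a" "a *\<^sub>C f"] by simp
    then have "cmod a * norm f \<le> norm (a *\<^sub>C f)"
      using False by (simp add: norm_divide field_simps)
    then show ?thesis using le[of a f] by simp
  qed
qed

end

section \<open>Duals, weak topologies and the diameter two property\<close>

text \<open>A linear subspace of a type is treated as a normed space in its own right: its dual consists
  of the bounded complex-linear functionals on the subspace (their values elsewhere are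
  irrelevant), and its weak topology is the coarsest one making them continuous.\<close>

definition dual_of :: "'a::complex_normed_vector set \<Rightarrow> ('a \<Rightarrow> complex) set"
  where "dual_of S = {\<phi>.
    (\<forall>x\<in>S. \<forall>y\<in>S. \<phi> (x + y) = \<phi> x + \<phi> y) \<and>
    (\<forall>c. \<forall>x\<in>S. \<phi> (c *\<^sub>C x) = c * \<phi> x) \<and>
    (\<exists>K. \<forall>x\<in>S. cmod (\<phi> x) \<le> K * norm x)}"

definition weak_topology_of :: "'a::complex_normed_vector set \<Rightarrow> 'a topology"
  where "weak_topology_of S =
    topology_generated_by {{x \<in> S. \<phi> x \<in> U} |\<phi> U. \<phi> \<in> dual_of S \<and> open U}"

definition diameter_two_property :: "'a::complex_normed_vector set \<Rightarrow> bool"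
  where "diameter_two_property S \<longleftrightarrow>
    (\<forall>W. openin (subtopology (weak_topology_of S) (S \<inter> cball 0 1)) W \<and> W \<noteq> {}
      \<longrightarrow> diameter W = 2)"

definition finite_dimensional :: "'a::complex_normed_vector set \<Rightarrow> bool"
  where "finite_dimensional S \<longleftrightarrow> (\<exists>B. finite B \<and> complex_vector.span B = S)"

section \<open>Function algebras and vector-valued function spaces over them\<close>

definition function_algebra :: "('w::t2_space \<Rightarrow>\<^sub>C complex) set \<Rightarrow> bool"
  where "function_algebra A \<longleftrightarrow>
    complex_vector.subspace A \<and> closed A \<and>
    (\<forall>f\<in>A. \<forall>g\<in>A. bcontfun_mult f g \<in> A) \<and>
    (\<forall>s t. s \<noteq> t \<longrightarrow> (\<exists>f\<in>A. apply_bcontfun f s \<noteq> apply_bcontfun f t)) \<and>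
    (\<forall>c. const_bcontfun c \<in> A)"

definition base_algebra ::
    "('w::t2_space \<Rightarrow>\<^sub>C 'x::complex_normed_vector) set \<Rightarrow> ('w \<Rightarrow>\<^sub>C complex) set"
  where "base_algebra F =
    {h. \<exists>f\<in>F. \<exists>\<phi>\<in>dual_of UNIV. apply_bcontfun h = \<phi> \<circ> apply_bcontfun f}"

definition function_space_over ::
    "('w::t2_space \<Rightarrow>\<^sub>C complex) set \<Rightarrow> ('w \<Rightarrow>\<^sub>C 'x::complex_normed_vector) set \<Rightarrow> bool"
  where "function_space_over A F \<longleftrightarrow>
    complex_vector.subspace F \<and> closed F \<and>
    A = base_algebra F \<and> function_algebra A \<and>
    (\<forall>f\<in>A. \<forall>g\<in>F. bcontfun_mult f g \<in> F)"

end

theory Submission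
  imports Defs
begin

text \<open>Call \<open>S\<close> a peak set if some \<open>g\<close> of norm one in the algebra stays away from modulus one off
  \<open>S\<close>. An infinite-dimensional algebra has arbitrarily many disjoint peak sets: given \<open>n\<close> of them,
  either one contains two disjoint smaller ones, or every \<open>h\<close> in the algebra converges along the
  filters of the \<open>n\<close> peaking functions. In the latter case the limits are linear functionals of \<open>h\<close>,
  some nonzero \<open>h\<close> lies in their common kernel, and the set where \<open>h\<close> is large is one more peak set.

  Composing a peaking function with a polynomial that maps the disc close to \<open>[0, 1]\<close> yields
  functions \<open>e\<^sub>j\<close> of norm almost one with \<open>\<bar>e\<^sub>j\<bar> + \<bar>1 - e\<^sub>j\<bar> \<le> 1 + \<eta>\<close> and with \<open>\<Sum> \<bar>e\<^sub>j\<bar> \<le> 3\<close>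
  independently of their number; hence products of the \<open>e\<^sub>j\<close> with elements of the unit ball become
  small on any finite set of functionals. For \<open>f\<close> in a weakly open part of the ball and a suitable
  \<open>h\<close> of norm one, \<open>(1 - e\<^sub>j) f + e\<^sub>j h\<close> and \<open>(1 - e\<^sub>j) f - e\<^sub>j h\<close> are, up to a factor close to one,
  still in that part, and their distance is almost two.\<close>

section \<open>Polynomials mapping the disc close to the unit interval\<close>

text \<open>The excess of \<open>cmod w + cmod (1 - w)\<close> over 1 measures how far
  \<open>w\<close> is from the segment between 0 and 1. The function \<open>q\<close> maps the
  closed disc into a thin rectangle around that segment and fixes 0 and 1. As \<open>r < 1\<close>,
  its power series converges uniformly on the disc, so a partial sum can replace it.\<close>

lemma polynomial_near_unit_interval:
  fixes \<epsilon> :: real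
  assumes "\<epsilon> > 0"
  obtains p :: "complex poly" where "poly p 0 = 0" "cmod (poly p 1 - 1) \<le> \<epsilon>"
    "\<And>z. cmod z \<le> 1 \<Longrightarrow> cmod (poly p z) + cmod (1 - poly p z) \<le> 1 + \<epsilon>"
proof -
  \<comment> \<open>The imaginary part of \<open>Ln\<close> is bounded on the right half-plane, so dividing by a large \<open>L\<close>
    flattens its image onto the real line; \<open>r\<close> is chosen to make \<open>q 1 = 1\<close>.\<close>
  define L where "L = 16 / \<epsilon>"
  define r where "r = 1 - exp (- L)"
  have L: "L > 0" using assms by (simp add: L_def)
  have r: "0 < r" "r < 1" using L by (simp_all add: r_def)
  define q where "q z = - Ln (1 - of_real r * z) / of_real L" for z :: complex
  \<comment> \<open>The term \<open>i = 0\<close> is a division by zero and hence zero, as in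
    \<open>Ln_series\<close>; so \<open>p n\<close> has no constant term.\<close>
  define p where "p n = (\<Sum>i<n. monom (of_real (r ^ i / (L * real i))) i :: complex poly)" for n
  have small: "cmod (of_real r * z) < 1" if "cmod z \<le> 1" for z
    using r that mult_left_mono[OF that, of r] le_less_trans[of "r * cmod z" r 1]
    by (simp add: norm_mult)
  have pn: "poly (p n) z = (\<Sum>i<n. (of_real r * z) ^ i / (of_real L * of_nat i))" for n z
    by (simp add: p_def poly_sum poly_monom power_mult_distrib)
  have sums: "(\<lambda>i. (of_real r * z) ^ i / (of_real L * of_nat i)) sums q z" if "cmod z \<le> 1" for z
  proof -
    have "(\<lambda>n. (-1) ^ Suc n / of_nat n * (- (of_real r * z)) ^ n) sums Ln (1 + - (of_real r * z))"
      using small[OF that] by (intro Ln_series) simp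
    then have "(\<lambda>n. - ((-1) ^ Suc n / of_nat n * (- (of_real r * z)) ^ n) / of_real L) sums q z"
      unfolding q_def by (intro sums_divide sums_minus) simp
    moreover have "- ((-1) ^ Suc n / of_nat n * (- (of_real r * z)) ^ n) / of_real L
        = (of_real r * z) ^ n / (of_real L * of_nat n)" for n
    proof -
      have "- ((-1) ^ Suc n * (- (of_real r * z)) ^ n) = (of_real r * z) ^ n"
        by (simp flip: power_mult_distrib)
      then show ?thesis by (simp add: field_simps)
    qed
    ultimately show ?thesis by (simp only:)
  qed
  have "uniform_limit (cball 0 1) (\<lambda>n (z::complex). \<Sum>i<n. (of_real r * z) ^ i / (of_real L * of_nat i))
      (\<lambda>z. suminf (\<lambda>i. (of_real r * z) ^ i / (of_real L * of_nat i))) sequentially"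
  proof (rule Weierstrass_m_test)
    show "summable (\<lambda>i. r ^ i / L)" using r by (intro summable_divide summable_geometric) simp
    show "cmod ((of_real r * z) ^ i / (of_real L * of_nat i)) \<le> r ^ i / L" if "z \<in> cball 0 1" for i z
    proof (cases "i = 0")
      case False
      have "cmod z ^ i \<le> 1" using that by (simp add: power_le_one)
      then have "r ^ i * cmod z ^ i / (L * real i) \<le> r ^ i * 1 / (L * 1)"
        using r L False by (intro frac_le mult_mono mult_nonneg_nonneg mult_pos_pos) auto
      then show ?thesis using r L
        by (simp add: norm_divide norm_mult norm_power power_mult_distrib)
    qed (use r L in simp)
  qed
  then have "\<forall>\<^sub>F n in sequentially. \<forall>z\<in>cball 0 1. dist (poly (p n) z)
      (suminf (\<lambda>i. (of_real r * z) ^ i / (of_real L * of_nat i))) < \<epsilon> / 4"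
    unfolding pn uniform_limit_iff using assms by (meson divide_pos_pos zero_less_numeral)
  from eventually_happens'[OF sequentially_bot this]
  obtain n where n: "\<forall>z\<in>cball 0 1. dist (poly (p n) z)
      (suminf (\<lambda>i. (of_real r * z) ^ i / (of_real L * of_nat i))) < \<epsilon> / 4" by blast
  have close: "cmod (poly (p n) z - q z) \<le> \<epsilon> / 4" if "cmod z \<le> 1" for z
  proof -
    have "z \<in> cball 0 1" using that by simp
    from bspec[OF n this] show ?thesis
      unfolding sums_unique[OF sums[OF that], symmetric] dist_norm by (rule less_imp_le)
  qed
  show ?thesis
  proof
    show "poly (p n) 0 = 0"
      by (simp add: pn) (rule sum.neutral, auto simp: power_0_left)
    have "1 - complex_of_real r = of_real (exp (-L))" by (simp add: r_def)
    then have "q 1 = 1" using L by (simp add: q_def del: of_real_exp flip: Ln_of_real) (simp add: Ln_of_real)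
    then show "cmod (poly (p n) 1 - 1) \<le> \<epsilon>" using close[of 1] assms by simp
    fix z :: complex assume z: "cmod z \<le> 1"
    define w where "w = 1 - of_real r * z"
    have Rw: "Re w > 0" using small[OF z] complex_Re_le_cmod[of "of_real r * z"] by (simp add: w_def)
    have w0: "w \<noteq> 0" using Rw by auto
    have "cmod w \<le> 2" using small[OF z] norm_triangle_ineq4[of 1 "of_real r * z"] by (simp add: w_def)
    have "exp (-L) \<le> cmod w"
    proof -
      have "cmod (of_real r * z) \<le> r" using z r by (simp add: norm_mult mult_left_le)
      then show ?thesis using norm_triangle_ineq2[of 1 "of_real r * z"] by (simp add: w_def r_def)
    qed
    then have lo: "- L \<le> ln (cmod w)" using w0 by (simp add: ln_ge_iff)
    have hi: "ln (cmod w) \<le> 1" using \<open>cmod w \<le> 2\<close> w0 ln_le_minus_one[of "cmod w"] by simp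
    have Im: "\<bar>Im (Ln w)\<bar> \<le> 2" using Re_Ln_pos_lt[OF w0] Rw pi_less_4 by auto
    define x where "x = - ln (cmod w) / L"
    have x: "Re (q z) = x" using w0 by (simp add: q_def x_def flip: w_def)
    have y: "\<bar>Im (q z)\<bar> \<le> 2 / L"
      using Im L by (simp add: q_def divide_right_mono flip: w_def)
    have "x \<le> 1" "- 1 / L \<le> x" using lo hi L unfolding x_def
      by (simp_all add: field_simps)
    then have "\<bar>x\<bar> + \<bar>1 - x\<bar> \<le> 1 + 2 / L" using L by (simp add: abs_if)
    moreover have "cmod (q z) \<le> \<bar>x\<bar> + 2 / L" using cmod_le[of "q z"] x y by linarith
    moreover have "cmod (1 - q z) \<le> \<bar>1 - x\<bar> + 2 / L" using cmod_le[of "1 - q z"] x y by simp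
    moreover have "2 / L = \<epsilon> / 8" by (simp add: L_def)
    moreover have "cmod (poly (p n) z) \<le> cmod (q z) + \<epsilon> / 4"
      using close[OF z] norm_triangle_sub[of "poly (p n) z" "q z"] by linarith
    moreover have "cmod (1 - poly (p n) z) \<le> cmod (1 - q z) + \<epsilon> / 4"
      using close[OF z] norm_triangle_ineq4[of "1 - q z" "poly (p n) z - q z"] by simp
    \<comment> \<open>Error budget: \<open>2 / L\<close> for the real part leaving the segment,
      \<open>2 / L\<close> for each of two imaginary parts and \<open>\<epsilon> / 4\<close> for
      each of two truncations, together 7/8 of \<open>\<epsilon>\<close>.\<close>
    ultimately show "cmod (poly (p n) z) + cmod (1 - poly (p n) z) \<le> 1 + \<epsilon>"
      using assms by linarith
  qed
qed

lemma bcontfun_norm_gt: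
  fixes g :: "'w::topological_space \<Rightarrow>\<^sub>C 'x::real_normed_vector"
  assumes "s < norm g"
  obtains t where "s < norm (apply_bcontfun g t)"
proof (rule ccontr)
  assume "\<not> thesis"
  then have "norm (apply_bcontfun g t) \<le> s" for t using that[of t] by (cases "s < norm (apply_bcontfun g t)") auto
  then have "norm g \<le> s" by (rule norm_bound)
  then show False using assms by simp
qed

lemma function_algebra_poly:
  assumes "function_algebra A" "g \<in> A"
  obtains e where "e \<in> A" "\<And>t. apply_bcontfun e t = poly p (apply_bcontfun g t)"
proof -
  have "\<exists>e\<in>A. \<forall>t. apply_bcontfun e t = poly p (apply_bcontfun g t)"
  proof (induction p)
    case 0
    then show ?case using assms by (intro bexI[of _ 0]) (auto simp: function_algebra_def intro: complex_vector.subspace_0)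
  next
    case (pCons a p)
    then obtain e where e: "e \<in> A" "\<And>t. apply_bcontfun e t = poly p (apply_bcontfun g t)" by blast
    have "const_bcontfun a + bcontfun_mult g e \<in> A"
      using assms e(1) by (auto simp: function_algebra_def intro: complex_vector.subspace_add)
    then show ?case
      by (rule bexI[rotated]) (simp add: e scaleC_complex_def)
  qed
  then show ?thesis using that by blast
qed

section \<open>Peak sets\<close>

text \<open>No point is required to attain modulus one, since the space need not be compact; only
  the uniform gap off \<open>S\<close> counts. In particular every superset of a peak set is a peak
  set.\<close>

definition peak_set :: "('w::t2_space \<Rightarrow>\<^sub>C complex) set \<Rightarrow> 'w set \<Rightarrow> bool"
  where "peak_set A S \<longleftrightarrow>
    (\<exists>g\<in>A. norm g = 1 \<and> (\<exists>r<1. \<forall>t. t \<notin> S \<longrightarrow> cmod (apply_bcontfun g t) \<le> r))"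

lemma peak_setI:
  assumes A: "function_algebra A" and "g \<in> A" "r < norm g" "g \<noteq> 0"
    and off: "\<And>t. t \<notin> S \<Longrightarrow> cmod (apply_bcontfun g t) \<le> r"
  shows "peak_set A S"
proof -
  let ?g = "of_real (1 / norm g) *\<^sub>C g"
  have "?g \<in> A" using assms by (auto simp: function_algebra_def intro: complex_vector.subspace_scale)
  moreover have "norm ?g = 1" using \<open>g \<noteq> 0\<close> by (simp add: norm_scaleC norm_divide)
  moreover have "r / norm g < 1" using assms by simp
  moreover have "cmod (apply_bcontfun ?g t) \<le> r / norm g" if "t \<notin> S" for t
    using off[OF that] by (simp add: norm_scaleC norm_divide divide_right_mono)
  ultimately show ?thesis unfolding peak_set_def by blast
qed

lemma peak_set_nonempty:
  assumes "peak_set A S"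
  shows "S \<noteq> {}"
proof
  assume "S = {}"
  then obtain g :: "'a \<Rightarrow>\<^sub>C complex" and r where "norm g = 1" "r < 1" "\<And>t. cmod (apply_bcontfun g t) \<le> r"
    using assms by (auto simp: peak_set_def)
  then show False using norm_bound[of g r] by simp
qed

text \<open>Here \<open>e\<close> is \<open>p\<close> applied to \<open>u * g ^ k\<close>. A large
  \<open>k\<close> sends the values off \<open>S\<close> close to 0, where \<open>p\<close>
  vanishes; the rotation \<open>u\<close> brings the value at one point \<open>s\<close> close to 1,
  where \<open>p\<close> is almost 1. The last bound holds for \<open>p\<close> on the whole
  disc.\<close>

lemma peak_function:
  assumes A: "function_algebra A" and S: "peak_set A S" and "\<epsilon> > 0"
  obtains e where "e \<in> A" "norm e \<ge> 1 - \<epsilon>"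
    "\<And>t. t \<notin> S \<Longrightarrow> cmod (apply_bcontfun e t) \<le> \<epsilon>"
    "\<And>t. cmod (apply_bcontfun e t) + cmod (1 - apply_bcontfun e t) \<le> 1 + \<epsilon>"
proof -
  obtain p where p: "poly p 0 = 0" "cmod (poly p 1 - 1) \<le> \<epsilon> / 2"
    "\<And>z. cmod z \<le> 1 \<Longrightarrow> cmod (poly p z) + cmod (1 - poly p z) \<le> 1 + \<epsilon> / 2"
    using polynomial_near_unit_interval[of "\<epsilon> / 2"] \<open>\<epsilon> > 0\<close> by auto
  have cont: "isCont (poly p) z" for z by simp
  obtain d0 where d0: "d0 > 0" "\<And>z. cmod z < d0 \<Longrightarrow> cmod (poly p z) < \<epsilon>"
    using cont[of 0] \<open>\<epsilon> > 0\<close> p(1) unfolding continuous_at_eps_delta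
    by (metis dist_norm diff_zero)
  obtain d1 where d1: "d1 > 0" "\<And>z. cmod (z - 1) < d1 \<Longrightarrow> cmod (poly p z - poly p 1) < \<epsilon> / 2"
    using cont[of 1] \<open>\<epsilon> > 0\<close> unfolding continuous_at_eps_delta
    by (metis dist_norm half_gt_zero)
  obtain g r0 where g: "g \<in> A" "norm g = 1" "r0 < 1" "\<And>t. t \<notin> S \<Longrightarrow> cmod (apply_bcontfun g t) \<le> r0"
    using S by (auto simp: peak_set_def)
  \<comment> \<open>\<open>r0\<close> may be negative if \<open>S\<close> is the whole space, and
    the powers below need a nonnegative base.\<close>
  define r where "r = max r0 0"
  have r: "0 \<le> r" "r < 1" "\<And>t. t \<notin> S \<Longrightarrow> cmod (apply_bcontfun g t) \<le> r"
    using g by (auto simp: r_def le_max_iff_disj)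
  obtain k where k: "r ^ k < d0" using real_arch_pow_inv[OF d0(1) r(2)] by blast
  \<comment> \<open>The point \<open>s\<close> is chosen after \<open>k\<close>: the modulus of
    \<open>g\<close> there must be so close to 1 that its \<open>k\<close>-th power is still within
    \<open>d1\<close> of 1.\<close>
  have "isCont (\<lambda>x::real. x ^ k) 1" by simp
  then obtain d2 where d2: "d2 > 0" "\<And>x. \<bar>x - 1\<bar> < d2 \<Longrightarrow> \<bar>x ^ k - 1\<bar> < d1"
    using d1(1) unfolding continuous_at_eps_delta by (auto simp: dist_real_def)
  obtain s where s: "1 - d2 < cmod (apply_bcontfun g s)"
    using bcontfun_norm_gt[of "1 - d2" g] g(2) d2(1) by auto
  have le1: "cmod (apply_bcontfun g t) \<le> 1" for t using norm_bounded[of g t] g(2) by simp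
  define a where "a = apply_bcontfun g s ^ k"
  define u where "u = cnj (sgn a)"
  have u: "cmod u \<le> 1" by (simp add: u_def norm_sgn)
  have ua: "u * a = of_real (cmod a)"
    by (cases "a = 0")
      (simp_all add: u_def sgn_div_norm scaleR_conv_of_real complex_norm_square[symmetric]
        field_simps power2_eq_square)
  obtain e where e: "e \<in> A" "\<And>t. apply_bcontfun e t = poly (p \<circ>\<^sub>p monom u k) (apply_bcontfun g t)"
    using function_algebra_poly[OF A g(1)] by blast
  have e': "apply_bcontfun e t = poly p (u * apply_bcontfun g t ^ k)" for t
    by (simp add: e poly_pcompose poly_monom)
  have b: "cmod (u * apply_bcontfun g t ^ k) \<le> cmod (apply_bcontfun g t) ^ k" for t
    using u by (simp add: norm_mult norm_power mult_left_le_one_le)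
  show ?thesis
  proof
    show "e \<in> A" by fact
    have "\<bar>cmod (apply_bcontfun g s) - 1\<bar> < d2" using s le1[of s] by simp
    then have "\<bar>cmod a - 1\<bar> < d1" using d2(2) by (simp add: a_def norm_power)
    then have "cmod (u * a - 1) < d1"
      unfolding ua by (metis norm_of_real of_real_1 of_real_diff)
    then have "cmod (apply_bcontfun e s - poly p 1) < \<epsilon> / 2" using d1(2) by (simp add: e' a_def)
    then have "cmod (apply_bcontfun e s) \<ge> 1 - \<epsilon>"
      using p(2) norm_triangle_ineq[of "1 - poly p 1" "poly p 1 - apply_bcontfun e s"]
        norm_triangle_ineq2[of 1 "apply_bcontfun e s"]
      by (simp add: norm_minus_commute)
    then show "norm e \<ge> 1 - \<epsilon>" using norm_bounded[of e s] by linarith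
    show "cmod (apply_bcontfun e t) \<le> \<epsilon>" if "t \<notin> S" for t
    proof -
      have "cmod (apply_bcontfun g t) ^ k \<le> r ^ k" using r(3)[OF that] by (simp add: power_mono)
      then show ?thesis using b[of t] k d0(2) unfolding e' by (meson le_less_trans less_imp_le)
    qed
    show "cmod (apply_bcontfun e t) + cmod (1 - apply_bcontfun e t) \<le> 1 + \<epsilon>" for t
      using p(3)[of "u * apply_bcontfun g t ^ k"] b[of t] le1[of t] \<open>\<epsilon> > 0\<close>
        power_le_one[of "cmod (apply_bcontfun g t)" k]
      unfolding e' by simp
  qed
qed

section \<open>Limits along the filter of a peaking function\<close>

text \<open>This filter replaces the set of points where the modulus of \<open>g\<close> is maximal,
  which may be empty.\<close>

definition peak_filter :: "('w::t2_space \<Rightarrow>\<^sub>C complex) \<Rightarrow> 'w filter"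
  where "peak_filter g = filtercomap (\<lambda>t. cmod (apply_bcontfun g t)) (nhds (norm g))"

text \<open>As the modulus of \<open>g\<close> never exceeds \<open>norm g\<close>, one-sided
  neighbourhoods of \<open>norm g\<close> suffice.\<close>

lemma eventually_peak_filter:
  "eventually P (peak_filter g) \<longleftrightarrow> (\<exists>r<norm g. \<forall>t. r < cmod (apply_bcontfun g t) \<longrightarrow> P t)"
proof
  assume "eventually P (peak_filter g)"
  then obtain U where U: "open U" "norm g \<in> U" "\<And>t. cmod (apply_bcontfun g t) \<in> U \<Longrightarrow> P t"
    by (auto simp: peak_filter_def eventually_filtercomap_nhds)
  obtain d where d: "d > 0" "\<And>x. dist x (norm g) < d \<Longrightarrow> x \<in> U"
    using U(1,2) unfolding open_dist by blast
  have "P t" if "norm g - d < cmod (apply_bcontfun g t)" for t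
    using that norm_bounded[of g t] by (intro U(3) d(2)) (simp add: dist_real_def)
  then show "\<exists>r<norm g. \<forall>t. r < cmod (apply_bcontfun g t) \<longrightarrow> P t"
    using d(1) by (intro exI[of _ "norm g - d"]) auto
next
  assume "\<exists>r<norm g. \<forall>t. r < cmod (apply_bcontfun g t) \<longrightarrow> P t"
  then obtain r where "r < norm g" "\<And>t. r < cmod (apply_bcontfun g t) \<Longrightarrow> P t" by blast
  then show "eventually P (peak_filter g)"
    unfolding peak_filter_def eventually_filtercomap_nhds
    by (intro exI[of _ "{r<..}"]) auto
qed

lemma peak_filter_tendsto:
  "((\<lambda>t. cmod (apply_bcontfun g t)) \<longlongrightarrow> norm g) (peak_filter g)"
  unfolding peak_filter_def by (rule filterlim_filtercomap)

lemma peak_filter_nontrivial: "peak_filter g \<noteq> bot"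
proof
  assume "peak_filter g = bot"
  then have "eventually (\<lambda>_. False) (peak_filter g)" by simp
  then show False by (auto simp: eventually_peak_filter elim: bcontfun_norm_gt)
qed

lemma peak_set_iff_eventually:
  fixes A :: "('w::t2_space \<Rightarrow>\<^sub>C complex) set"
  shows "peak_set A S \<longleftrightarrow> (\<exists>g\<in>A. norm g = 1 \<and> eventually (\<lambda>t. t \<in> S) (peak_filter g))"
proof -
  have "(t \<notin> S \<longrightarrow> cmod (apply_bcontfun g t) \<le> r) = (r < cmod (apply_bcontfun g t) \<longrightarrow> t \<in> S)"
    for g :: "'w \<Rightarrow>\<^sub>C complex" and r t by auto
  then show ?thesis unfolding peak_set_def eventually_peak_filter by (simp cong: conj_cong)
qed

text \<open>For small \<open>\<eta>\<close> the modulus of \<open>1 + \<eta> h\<close> is governed by \<open>Re h\<close>, and multiplication by a high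
  power of \<open>g\<close> localises to the peak set of \<open>g\<close>.\<close>

lemma peak_set_Re_gt:
  assumes A: "function_algebra A" and g: "g \<in> A" "norm g = 1" and h: "h \<in> A"
    and S: "eventually (\<lambda>t. t \<in> S) (peak_filter g)"
    and q: "frequently (\<lambda>t. Re (apply_bcontfun h t) > q) (peak_filter g)" and "p < q"
  shows "peak_set A {t \<in> S. Re (apply_bcontfun h t) > p}"
proof -
  \<comment> \<open>\<open>M\<close> includes \<open>\<bar>p\<bar>\<close> so that
    \<open>1 + \<eta> * p'\<close> stays positive. The bound
    \<open>\<eta> * M\<^sup>2 \<le> q - p\<close> makes the quadratic term of the squared modulus of
    \<open>1 + \<eta> h\<close> at most \<open>\<eta> * (q - p)\<close>. Where
    \<open>Re h \<le> p\<close>, that square is then at most \<open>1 + 2 * \<eta> * p'\<close>,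
    hence at most the square of \<open>1 + \<eta> * p'\<close>.\<close>
  define M where "M = norm h + 1 + \<bar>p\<bar>"
  define \<eta> where "\<eta> = min (1 / (2 * M)) ((q - p) / M\<^sup>2)"
  define p' where "p' = (p + q) / 2"
  have M: "M \<ge> 1" by (simp add: M_def)
  have hM: "cmod (apply_bcontfun h t) \<le> M" for t
    using norm_bounded[of h t] by (simp add: M_def)
  have \<eta>: "\<eta> > 0" "\<eta> * M \<le> 1 / 2" "\<eta> * M\<^sup>2 \<le> q - p"
    using M \<open>p < q\<close> by (auto simp: \<eta>_def min_def field_simps)
  have p': "p < p'" "p' < q" using \<open>p < q\<close> by (auto simp: p'_def)
  have "\<eta> * p' \<ge> \<eta> * (- M)" using \<eta>(1) p' norm_ge_zero[of h]
    by (intro mult_left_mono) (auto simp: M_def simp del: norm_ge_zero)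
  then have pos: "1 + \<eta> * p' > 0" using \<eta>(2) by simp
  obtain r0 where r0: "r0 < 1" "\<And>t. r0 < cmod (apply_bcontfun g t) \<Longrightarrow> t \<in> S"
    using S g(2) by (auto simp: eventually_peak_filter)
  define r where "r = max r0 0"
  have r: "0 \<le> r" "r < 1" "\<And>t. t \<notin> S \<Longrightarrow> cmod (apply_bcontfun g t) \<le> r"
    using r0 by (auto simp: r_def le_max_iff_disj not_less[symmetric])
  \<comment> \<open>Off \<open>S\<close> the factor \<open>1 + \<eta> h\<close> has modulus at most
    2, so half the threshold is what the power of \<open>g\<close> has to stay below.\<close>
  obtain k where k: "r ^ k < (1 + \<eta> * p') / 2"
    using real_arch_pow_inv[of "(1 + \<eta> * p') / 2" r] pos r(2) by auto
  obtain gk where gk: "gk \<in> A" "\<And>t. apply_bcontfun gk t = poly (monom 1 k) (apply_bcontfun g t)"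
    using function_algebra_poly[OF A g(1)] by blast
  obtain h' where h': "h' \<in> A" "\<And>t. apply_bcontfun h' t = poly [:1, of_real \<eta>:] (apply_bcontfun h t)"
    using function_algebra_poly[OF A h] by blast
  define f where "f = bcontfun_mult gk h'"
  have f: "cmod (apply_bcontfun f t)
      = cmod (apply_bcontfun g t) ^ k * cmod (1 + of_real \<eta> * apply_bcontfun h t)" for t
    by (simp add: f_def gk h' poly_monom scaleC_complex_def norm_mult norm_power mult.commute)
  \<comment> \<open>On the peak the power costs nothing in the limit: eventually the loss is smaller
    than the gap between \<open>p'\<close> and \<open>q\<close>, and frequently
    \<open>Re h > q\<close> at the same time.\<close>
  have "((\<lambda>t. cmod (apply_bcontfun g t) ^ k * (1 + \<eta> * q)) \<longlongrightarrow> 1 ^ k * (1 + \<eta> * q)) (peak_filter g)"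
    using peak_filter_tendsto[of g] g(2) by (intro tendsto_intros) simp
  moreover have "1 + \<eta> * p' < 1 ^ k * (1 + \<eta> * q)" using \<eta>(1) p'(2) by simp
  ultimately have "eventually (\<lambda>t. 1 + \<eta> * p' < cmod (apply_bcontfun g t) ^ k * (1 + \<eta> * q)) (peak_filter g)"
    by (rule order_tendstoD)
  then obtain s where s: "1 + \<eta> * p' < cmod (apply_bcontfun g s) ^ k * (1 + \<eta> * q)"
      "Re (apply_bcontfun h s) > q"
    using q frequently_ex by (metis (mono_tags, lifting) frequently_def not_eventually eventually_mono)
  have "1 + \<eta> * q \<le> cmod (1 + of_real \<eta> * apply_bcontfun h s)"
    using complex_Re_le_cmod[of "1 + of_real \<eta> * apply_bcontfun h s"] s(2) \<eta>(1)
    by (simp add: order_trans[rotated])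
  then have "1 + \<eta> * p' < cmod (apply_bcontfun f s)"
    unfolding f using s(1) by (meson less_le_trans mult_left_mono norm_ge_zero zero_le_power)
  then have norm_f: "1 + \<eta> * p' < norm f" using norm_bounded[of f s] by linarith
  show ?thesis
  proof (rule peak_setI[OF A _ norm_f])
    show "f \<in> A" using A gk(1) h'(1) by (auto simp: f_def function_algebra_def)
    show "f \<noteq> 0" using norm_f pos by auto
    fix t assume t: "t \<notin> {t \<in> S. Re (apply_bcontfun h t) > p}"
    let ?h = "1 + of_real \<eta> * apply_bcontfun h t"
    show "cmod (apply_bcontfun f t) \<le> 1 + \<eta> * p'"
    proof (cases "t \<in> S")
      case False
      have "cmod ?h \<le> 1 + \<eta> * cmod (apply_bcontfun h t)"
        using \<eta>(1) norm_triangle_ineq[of 1 "of_real \<eta> * apply_bcontfun h t"]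
        by (simp add: norm_mult)
      also have "\<dots> \<le> 1 + \<eta> * M" using \<eta>(1) hM[of t] by simp
      finally have "cmod ?h \<le> 1 + \<eta> * M" .
      then have "cmod ?h \<le> 2" using \<eta>(2) by simp
      moreover have "cmod (apply_bcontfun g t) ^ k \<le> r ^ k" using r(3)[OF False] by (simp add: power_mono)
      ultimately have "cmod (apply_bcontfun f t) \<le> r ^ k * 2"
        unfolding f using r(1) by (intro mult_mono) auto
      then show ?thesis using k by simp
    next
      case True
      then have "Re (apply_bcontfun h t) \<le> p" using t by auto
      then have "\<eta> * Re (apply_bcontfun h t) \<le> \<eta> * p" using \<eta>(1) by simp
      moreover have "(cmod ?h)\<^sup>2 = 1 + 2 * (\<eta> * Re (apply_bcontfun h t)) + \<eta>\<^sup>2 * (cmod (apply_bcontfun h t))\<^sup>2"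
        unfolding cmod_power2 by (simp add: power2_eq_square algebra_simps)
      moreover have "\<eta>\<^sup>2 * (cmod (apply_bcontfun h t))\<^sup>2 \<le> \<eta>\<^sup>2 * M\<^sup>2"
        using hM[of t] by (intro mult_left_mono power_mono) auto
      moreover have "\<eta>\<^sup>2 * M\<^sup>2 \<le> \<eta> * (q - p)"
        using mult_left_mono[OF \<eta>(3), of \<eta>] \<eta>(1) by (simp add: power2_eq_square mult.assoc)
      moreover have "(1 + \<eta> * p')\<^sup>2 = 1 + \<eta> * p + \<eta> * q + (\<eta> * p')\<^sup>2"
        by (simp add: p'_def power2_eq_square field_simps)
      ultimately have "(cmod ?h)\<^sup>2 \<le> (1 + \<eta> * p')\<^sup>2"
        using zero_le_power2[of "\<eta> * p'"] unfolding right_diff_distrib by linarith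
      then have "cmod ?h \<le> 1 + \<eta> * p'" using pos by (rule power2_le_imp_le[OF _ less_imp_le])
      moreover have "cmod (apply_bcontfun g t) ^ k \<le> 1"
        using norm_bounded[of g t] g(2) by (intro power_le_one) auto
      ultimately show ?thesis
        unfolding f by (intro order_trans[OF mult_left_le_one_le]) auto
    qed
  qed
qed

text \<open>A line separating two cluster values of \<open>h\<close> would split \<open>S\<close>.\<close>

lemma peak_filter_converges:
  assumes A: "function_algebra A" and g: "g \<in> A" "norm g = 1" and h: "h \<in> A"
    and S: "eventually (\<lambda>t. t \<in> S) (peak_filter g)"
    and unsplit: "\<And>S1 S2. \<lbrakk>peak_set A S1; peak_set A S2; S1 \<subseteq> S; S2 \<subseteq> S\<rbrakk> \<Longrightarrow> S1 \<inter> S2 \<noteq> {}"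
  obtains c where "(apply_bcontfun h \<longlongrightarrow> c) (peak_filter g)"
proof (rule ccontr)
  assume "\<not> thesis"
  then have div: "\<not> (apply_bcontfun h \<longlongrightarrow> c) (peak_filter g)" for c using that by blast
  let ?F = "filtermap (apply_bcontfun h) (peak_filter g)"
  \<comment> \<open>The values of \<open>h\<close> lie in a compact disc, so every proper filter
    finer than the image filter has a cluster point.\<close>
  have cpt: "\<exists>x\<in>cball 0 (norm h). inf (nhds x) F \<noteq> bot"
    if "F \<noteq> bot" "F \<le> ?F" for F :: "complex filter"
  proof -
    have "eventually (\<lambda>x. x \<in> cball 0 (norm h)) ?F"
      by (simp add: eventually_filtermap norm_bounded)
    then have "eventually (\<lambda>x. x \<in> cball 0 (norm h)) F" using that(2) filter_leD by blast
    then show ?thesis using that(1) compact_cball[of 0 "norm h"] unfolding compact_filter by blast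
  qed
  have "?F \<noteq> bot" using peak_filter_nontrivial by (simp add: filtermap_bot_iff)
  then obtain c1 where c1: "inf (nhds c1) ?F \<noteq> bot" using cpt by blast
  \<comment> \<open>Since \<open>h\<close> does not converge to \<open>c1\<close>, the image filter
    remains proper when restricted to the complement of some open \<open>U\<close> around
    \<open>c1\<close>. A cluster point \<open>c2\<close> of the restriction lies outside
    \<open>U\<close>.\<close>
  from div[of c1] obtain U where U: "open U" "c1 \<in> U"
      "\<not> eventually (\<lambda>t. apply_bcontfun h t \<in> U) (peak_filter g)"
    by (auto simp: tendsto_def)
  have "inf ?F (principal (- U)) \<noteq> bot"
    using U(3) by (auto simp: trivial_limit_def eventually_inf_principal eventually_filtermap)
  then obtain c2 where "inf (nhds c2) (inf ?F (principal (- U))) \<noteq> bot" using cpt inf_le1 by blast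
  then have c2: "inf (nhds c2) ?F \<noteq> bot" "inf (nhds c2) (principal (- U)) \<noteq> bot"
    by (metis inf_assoc inf_bot_left, metis inf_left_commute inf_bot_right)
  have "c2 \<notin> U"
    using c2(2) U(1) eventually_nhds_in_open[of U c2]
    by (auto simp: trivial_limit_def eventually_inf_principal)
  then have "c1 \<noteq> c2" using U(2) by auto
  have freq: "frequently (\<lambda>t. apply_bcontfun h t \<in> V) (peak_filter g)"
    if "open V" "c \<in> V" "inf (nhds c) ?F \<noteq> bot" for V c
  proof (rule ccontr)
    assume "\<not> frequently (\<lambda>t. apply_bcontfun h t \<in> V) (peak_filter g)"
    then have "eventually (\<lambda>z. z \<notin> V) ?F" by (simp add: frequently_def eventually_filtermap)
    moreover have "eventually (\<lambda>z. z \<in> V) (nhds c)" using that by (simp add: eventually_nhds_in_open)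
    ultimately have "eventually (\<lambda>_. False) (inf (nhds c) ?F)"
      unfolding eventually_inf by blast
    then show False using that(3) by (simp add: trivial_limit_def)
  qed
  \<comment> \<open>Multiplication by \<open>u\<close> turns the direction from \<open>c1\<close> to
    \<open>c2\<close> into the positive real one, so the real part separates the two values, with
    midpoint \<open>m\<close>.\<close>
  define u where "u = cnj (c2 - c1)"
  define m where "m = (Re (u * c1) + Re (u * c2)) / 2"
  have "Re (u * c2) - Re (u * c1) = (cmod (c2 - c1))\<^sup>2"
    unfolding cmod_power2 by (simp add: u_def power2_eq_square algebra_simps)
  then have gap: "Re (u * c1) < Re (u * c2)" using \<open>c1 \<noteq> c2\<close>
    by (metis diff_gt_0_iff_gt right_minus_eq zero_less_norm_iff zero_less_power)
  \<comment> \<open>\<open>q\<close> and \<open>q'\<close> leave a margin on either side of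
    \<open>m\<close>, because \<open>peak_set_Re_gt\<close> only yields a level strictly below the
    one reached frequently.\<close>
  define q where "q = (m + Re (u * c2)) / 2"
  define q' where "q' = (m + Re (u * c1)) / 2"
  have order: "Re (u * c1) < q'" "q' < m" "m < q" "q < Re (u * c2)"
    using gap by (simp_all add: m_def q_def q'_def del: times_complex.simps)
  have "frequently (\<lambda>t. apply_bcontfun h t \<in> {z. q < Re (u * z)}) (peak_filter g)"
    using order c2(1) by (intro freq[of _ c2] open_Collect_less continuous_intros) auto
  then have S1: "peak_set A {t \<in> S. Re (apply_bcontfun (u *\<^sub>C h) t) > m}"
    using A h g S order
    by (intro peak_set_Re_gt[where q = q])
      (auto simp: scaleC_complex_def function_algebra_def intro: complex_vector.subspace_scale)
  have uh: "(- u) *\<^sub>C h \<in> A"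
    using A h by (auto simp: function_algebra_def simp del: complex_vector.scale_minus_left
        intro: complex_vector.subspace_scale)
  have "frequently (\<lambda>t. apply_bcontfun h t \<in> {z. Re (u * z) < q'}) (peak_filter g)"
    using order c1 by (intro freq[of _ c1] open_Collect_less continuous_intros) auto
  then have S2: "peak_set A {t \<in> S. Re (apply_bcontfun ((- u) *\<^sub>C h) t) > - m}"
    using A uh g S order
    by (intro peak_set_Re_gt[where q = "- q'"])
      (auto simp: scaleC_complex_def algebra_simps elim!: frequently_elim1)
  from unsplit[OF S1 S2] show False by (auto simp: scaleC_complex_def)
qed

section \<open>Disjoint peak sets from infinite dimension\<close>

text \<open>The kernel has codimension at most one: adding one vector \<open>v\<close> with
  \<open>\<psi> v \<noteq> 0\<close> to a spanning set of the kernel spans \<open>V\<close>.\<close>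

lemma infinite_dimensional_kernel:
  assumes V: "complex_vector.subspace V" "\<not> finite_dimensional V"
    and add: "\<And>x y. x \<in> V \<Longrightarrow> y \<in> V \<Longrightarrow> \<psi> (x + y) = \<psi> x + \<psi> y"
    and scale: "\<And>c x. x \<in> V \<Longrightarrow> \<psi> (c *\<^sub>C x) = c * (\<psi> x :: complex)"
  shows "complex_vector.subspace {x \<in> V. \<psi> x = 0}" "\<not> finite_dimensional {x \<in> V. \<psi> x = 0}"
proof -
  have V0: "0 \<in> V" using V(1) complex_vector.subspace_0 by blast
  show "complex_vector.subspace {x \<in> V. \<psi> x = 0}"
    using V(1) V0 scale[OF V0, of 0] add scale
    by (auto simp: complex_vector.subspace_def)
  show "\<not> finite_dimensional {x \<in> V. \<psi> x = 0}"
  proof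
    assume "finite_dimensional {x \<in> V. \<psi> x = 0}"
    then obtain B where B: "finite B" "complex_vector.span B = {x \<in> V. \<psi> x = 0}"
      by (auto simp: finite_dimensional_def)
    have "\<exists>v\<in>V. \<psi> v \<noteq> 0"
    proof (rule ccontr)
      assume "\<not> ?thesis"
      then have "complex_vector.span B = V" using B(2) by auto
      then show False using V(2) B(1) by (auto simp: finite_dimensional_def)
    qed
    then obtain v where v: "v \<in> V" "\<psi> v \<noteq> 0" by blast
    have "complex_vector.span (insert v B) = V"
    proof
      have "B \<subseteq> V" using B(2) complex_vector.span_superset by blast
      then show "complex_vector.span (insert v B) \<subseteq> V"
        using v V(1) by (intro complex_vector.span_minimal) auto
      show "V \<subseteq> complex_vector.span (insert v B)"
      proof
        fix x assume x: "x \<in> V"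
        obtain c where c: "\<psi> x = c * \<psi> v" using v(2) by (metis nonzero_eq_divide_eq)
        have cv: "(- c) *\<^sub>C v \<in> V" using V(1) v(1) complex_vector.subspace_scale by blast
        have "\<psi> (x + (- c) *\<^sub>C v) = 0" unfolding add[OF x cv] scale[OF v(1)] c by simp
        moreover have "x + (- c) *\<^sub>C v \<in> V" using V(1) x cv by (rule complex_vector.subspace_add)
        ultimately have "x - c *\<^sub>C v \<in> complex_vector.span B" by (simp add: B(2))
        then show "x \<in> complex_vector.span (insert v B)"
          using complex_vector.span_breakdown_eq by blast
      qed
    qed
    then show False using V(2) B(1) finite_dimensional_def by blast
  qed
qed

text \<open>Intersecting with one kernel at a time keeps the dimension infinite, so the final
  intersection is not zero.\<close>

lemma infinite_dimensional_common_kernel: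
  assumes V: "complex_vector.subspace V" "\<not> finite_dimensional V"
    and add: "\<And>i x y. (i::nat) < n \<Longrightarrow> x \<in> V \<Longrightarrow> y \<in> V \<Longrightarrow> \<psi> i (x + y) = \<psi> i x + \<psi> i y"
    and scale: "\<And>i c x. i < n \<Longrightarrow> x \<in> V \<Longrightarrow> \<psi> i (c *\<^sub>C x) = c * (\<psi> i x :: complex)"
  obtains x where "x \<in> V" "x \<noteq> 0" "\<And>i. i < n \<Longrightarrow> \<psi> i x = 0"
proof -
  have "complex_vector.subspace {x \<in> V. \<forall>i<m. \<psi> i x = 0}
      \<and> \<not> finite_dimensional {x \<in> V. \<forall>i<m. \<psi> i x = 0}" if "m \<le> n" for m
    using that
  proof (induction m)
    case 0
    then show ?case using V by simp
  next
    case (Suc m)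
    let ?W = "{x \<in> V. \<forall>i<m. \<psi> i x = 0}"
    have eq: "{x \<in> V. \<forall>i<Suc m. \<psi> i x = 0} = {x \<in> ?W. \<psi> m x = 0}"
      by (auto simp: less_Suc_eq)
    show ?case unfolding eq
      using infinite_dimensional_kernel[of ?W "\<psi> m"] Suc add scale by auto
  qed
  then have W: "complex_vector.subspace {x \<in> V. \<forall>i<n. \<psi> i x = 0}"
      "\<not> finite_dimensional {x \<in> V. \<forall>i<n. \<psi> i x = 0}" by auto
  have "{x \<in> V. \<forall>i<n. \<psi> i x = 0} \<noteq> {0}"
    using W(2) unfolding finite_dimensional_def
    by (metis complex_vector.span_empty finite.emptyI)
  then show ?thesis using that complex_vector.subspace_0[OF W(1)] by blast
qed

lemma disjoint_peak_sets:
  fixes A :: "('w::t2_space \<Rightarrow>\<^sub>C complex) set" and n :: nat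
  assumes A: "function_algebra A" "\<not> finite_dimensional A"
  shows "\<exists>S. disjoint_family_on S {..<n} \<and> (\<forall>i<n. peak_set A (S i))"
proof (induction n)
  case 0
  then show ?case by (simp add: disjoint_family_on_def)
next
  case (Suc n)
  then obtain S where disj: "disjoint_family_on S {..<n}" and S: "\<And>i. i < n \<Longrightarrow> peak_set A (S i)"
    by blast
  have sub: "complex_vector.subspace A" using A(1) by (simp add: function_algebra_def)
  show ?case
  proof (cases "\<exists>i<n. \<exists>S1 S2. peak_set A S1 \<and> peak_set A S2 \<and> S1 \<subseteq> S i \<and> S2 \<subseteq> S i \<and> S1 \<inter> S2 = {}")
    case True
    then obtain i S1 S2 where i: "i < n" "peak_set A S1" "peak_set A S2" "S1 \<subseteq> S i" "S2 \<subseteq> S i"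
        "S1 \<inter> S2 = {}" by blast
    define T where "T = S(i := S1, n := S2)"
    have dS: "S j \<inter> S k = {}" if "j < n" "k < n" "j \<noteq> k" for j k
      using disj that by (auto simp: disjoint_family_on_def)
    have "T j \<inter> T k = {}" if "j < k" "k < Suc n" for j k
    proof -
      \<comment> \<open>For \<open>j < k\<close> only \<open>k\<close> can be \<open>n\<close>, and
        \<open>T n = S2\<close> lies in \<open>S i\<close>. So an overlap lies in
        \<open>S1 \<inter> S2\<close> or in the overlap of two different old sets.\<close>
      have "T j \<inter> T k \<subseteq> S1 \<inter> S2 \<union> (if k = n then if j = i then {} else S j \<inter> S i else S j \<inter> S k)"
        using that i by (auto simp: T_def)
      then show ?thesis using dS[of j i] dS[of j k] i that by (auto split: if_splits)
    qed
    then have "disjoint_family_on T {..<Suc n}"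
      unfolding disjoint_family_on_def by (metis Int_commute lessThan_iff linorder_neqE_nat)
    moreover have "\<forall>j<Suc n. peak_set A (T j)" using S i by (auto simp: T_def less_Suc_eq)
    ultimately show ?thesis by blast
  next
    case False
    have "\<forall>i\<in>{..<n}. \<exists>g. g \<in> A \<and> norm g = 1 \<and> eventually (\<lambda>t. t \<in> S i) (peak_filter g)"
      using S unfolding peak_set_iff_eventually Bex_def by simp
    then obtain g where g: "\<And>i. i < n \<Longrightarrow> g i \<in> A" "\<And>i. i < n \<Longrightarrow> norm (g i) = 1"
        "\<And>i. i < n \<Longrightarrow> eventually (\<lambda>t. t \<in> S i) (peak_filter (g i))"
      by (metis bchoice lessThan_iff)
    \<comment> \<open>No \<open>S i\<close> contains two disjoint peak sets, so nothing obstructs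
      convergence of any \<open>h\<close> along any of the \<open>n\<close> filters.\<close>
    have "\<exists>c. (apply_bcontfun h \<longlongrightarrow> c) (peak_filter (g i))" if "i < n" "h \<in> A" for i h
      using peak_filter_converges[OF A(1) g(1)[OF that(1)] g(2)[OF that(1)] that(2) g(3)[OF that(1)]]
        False that(1) by metis
    then obtain \<psi> where \<psi>: "\<And>i h. i < n \<Longrightarrow> h \<in> A \<Longrightarrow> (apply_bcontfun h \<longlongrightarrow> \<psi> i h) (peak_filter (g i))"
      by metis
    obtain h where h: "h \<in> A" "h \<noteq> 0" "\<And>i. i < n \<Longrightarrow> \<psi> i h = 0"
    proof (rule infinite_dimensional_common_kernel[OF sub A(2)])
      fix i x y assume i: "i < n" and xy: "x \<in> A" "y \<in> A"
      have "x + y \<in> A" using sub xy by (rule complex_vector.subspace_add)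
      have "(apply_bcontfun (x + y) \<longlongrightarrow> \<psi> i x + \<psi> i y) (peak_filter (g i))"
        using tendsto_add[OF \<psi>[OF i xy(1)] \<psi>[OF i xy(2)]] by (simp add: plus_bcontfun.rep_eq)
      with \<psi>[OF i \<open>x + y \<in> A\<close>] show "\<psi> i (x + y) = \<psi> i x + \<psi> i y"
        by (rule tendsto_unique[OF peak_filter_nontrivial])
    next
      fix i c x assume i: "i < n" and x: "x \<in> A"
      have "c *\<^sub>C x \<in> A" using sub x by (rule complex_vector.subspace_scale)
      have "apply_bcontfun (c *\<^sub>C x) = (\<lambda>t. c * apply_bcontfun x t)"
        by (simp add: fun_eq_iff scaleC_complex_def)
      then have "(apply_bcontfun (c *\<^sub>C x) \<longlongrightarrow> c * \<psi> i x) (peak_filter (g i))"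
        using tendsto_mult_left[OF \<psi>[OF i x]] by simp
      with \<psi>[OF i \<open>c *\<^sub>C x \<in> A\<close>] show "\<psi> i (c *\<^sub>C x) = c * \<psi> i x"
        by (rule tendsto_unique[OF peak_filter_nontrivial])
    qed blast
    \<comment> \<open>\<open>h\<close> tends to 0 along every filter, so cutting each
      \<open>S i\<close> down to \<open>H\<close> keeps it a peak set; off \<open>H\<close> the
      modulus of \<open>h\<close> is at least half its norm, so \<open>h\<close> itself shows that
      \<open>- H\<close> is a peak set.\<close>
    define H where "H = {t. cmod (apply_bcontfun h t) < norm h / 2}"
    define T where "T i = (if i < n then S i \<inter> H else - H)" for i
    have "disjoint_family_on T {..<Suc n}"
      using disj by (auto simp: disjoint_family_on_def T_def)
    moreover have "peak_set A (T i)" if "i < Suc n" for i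
    proof (cases "i < n")
      case True
      have "((\<lambda>t. cmod (apply_bcontfun h t)) \<longlongrightarrow> 0) (peak_filter (g i))"
        using tendsto_norm[OF \<psi>[OF True h(1)]] h(3)[OF True] by simp
      then have "eventually (\<lambda>t. cmod (apply_bcontfun h t) < norm h / 2) (peak_filter (g i))"
        using h(2) by (intro order_tendstoD(2)) auto
      with g(3)[OF True] have "eventually (\<lambda>t. t \<in> T i) (peak_filter (g i))"
        by eventually_elim (use True in \<open>auto simp: T_def H_def\<close>)
      then show ?thesis using g(1,2)[OF True] unfolding peak_set_iff_eventually by blast
    next
      case False
      have "peak_set A (- H)"
        by (rule peak_setI[OF A(1) h(1), of "norm h / 2"]) (use h(2) in \<open>auto simp: H_def\<close>)
      then show ?thesis using False by (simp add: T_def)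
    qed
    ultimately show ?thesis by blast
  qed
qed

section \<open>Weakly open sets\<close>

text \<open>Induction over the generation of \<open>V\<close> from subbasic sets with
  \<open>x\<close> fixed: an intersection unites the two finite families and takes the smaller
  \<open>\<epsilon>\<close>, a union keeps the data of one member containing
  \<open>x\<close>.\<close>

lemma weak_topology_of_neighbourhood:
  assumes "openin (weak_topology_of S) V" "x \<in> V"
  obtains \<Phi> \<epsilon> where "finite \<Phi>" "\<Phi> \<subseteq> dual_of S" "\<epsilon> > 0"
    "\<And>y. y \<in> S \<Longrightarrow> (\<And>\<phi>. \<phi> \<in> \<Phi> \<Longrightarrow> cmod (\<phi> y - \<phi> x) < \<epsilon>) \<Longrightarrow> y \<in> V"
proof -
  let ?P = "\<lambda>V x. \<exists>\<Phi> \<epsilon>. finite \<Phi> \<and> \<Phi> \<subseteq> dual_of S \<and> \<epsilon> > 0 \<and>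
    (\<forall>y\<in>S. (\<forall>\<phi>\<in>\<Phi>. cmod (\<phi> y - \<phi> x) < \<epsilon>) \<longrightarrow> y \<in> V)"
  have "generate_topology_on {{x \<in> S. \<phi> x \<in> U} |\<phi> U. \<phi> \<in> dual_of S \<and> open U} V"
    using assms(1) by (simp add: weak_topology_of_def openin_topology_generated_by_iff)
  then have "x \<in> V \<Longrightarrow> ?P V x"
  proof (induction V)
    case Empty
    then show ?case by simp
  next
    case (Int V1 V2)
    then obtain \<Phi>1 \<epsilon>1 \<Phi>2 \<epsilon>2 where
      "finite \<Phi>1" "\<Phi>1 \<subseteq> dual_of S" "\<epsilon>1 > (0::real)"
      "\<forall>y\<in>S. (\<forall>\<phi>\<in>\<Phi>1. cmod (\<phi> y - \<phi> x) < \<epsilon>1) \<longrightarrow> y \<in> V1"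
      "finite \<Phi>2" "\<Phi>2 \<subseteq> dual_of S" "\<epsilon>2 > (0::real)"
      "\<forall>y\<in>S. (\<forall>\<phi>\<in>\<Phi>2. cmod (\<phi> y - \<phi> x) < \<epsilon>2) \<longrightarrow> y \<in> V2" by blast
    then show ?case
      by (intro exI[of _ "\<Phi>1 \<union> \<Phi>2"] exI[of _ "min \<epsilon>1 \<epsilon>2"]) auto
  next
    case (UN K)
    then obtain k where k: "k \<in> K" "x \<in> k" by blast
    then obtain \<Phi> \<epsilon> where "finite \<Phi>" "\<Phi> \<subseteq> dual_of S" "\<epsilon> > (0::real)"
      and "\<forall>y\<in>S. (\<forall>\<phi>\<in>\<Phi>. cmod (\<phi> y - \<phi> x) < \<epsilon>) \<longrightarrow> y \<in> k" using UN.IH[of k] by auto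
    then show ?case using k(1) by (intro exI[of _ \<Phi>] exI[of _ \<epsilon>]) auto
  next
    case (Basis V)
    then obtain \<phi> U where V: "V = {x \<in> S. \<phi> x \<in> U}" "\<phi> \<in> dual_of S" "open U" by blast
    then obtain \<epsilon> where "\<epsilon> > 0" "\<And>z. dist z (\<phi> x) < \<epsilon> \<Longrightarrow> z \<in> U"
      using Basis unfolding open_dist by blast
    then show ?case using V by (intro exI[of _ "{\<phi>}"] exI[of _ \<epsilon>]) (auto simp: dist_norm)
  qed
  from this[OF assms(2)] obtain \<Phi> \<epsilon> where "finite \<Phi> \<and> \<Phi> \<subseteq> dual_of S \<and> \<epsilon> > 0 \<and>
    (\<forall>y\<in>S. (\<forall>\<phi>\<in>\<Phi>. cmod (\<phi> y - \<phi> x) < \<epsilon>) \<longrightarrow> y \<in> V)" by (elim exE)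
  then show ?thesis by (intro that[of \<Phi> \<epsilon>]) simp_all
qed

section \<open>Functionals on sums and norms of products\<close>

lemma dual_of_bound:
  assumes "\<phi> \<in> dual_of S"
  obtains K where "K \<ge> 0" "\<And>x. x \<in> S \<Longrightarrow> cmod (\<phi> x) \<le> K * norm x"
proof -
  obtain K where K: "\<And>x. x \<in> S \<Longrightarrow> cmod (\<phi> x) \<le> K * norm x"
    using assms unfolding dual_of_def by blast
  have "cmod (\<phi> x) \<le> \<bar>K\<bar> * norm x" if "x \<in> S" for x
    using K[OF that] mult_right_mono[OF abs_ge_self norm_ge_zero] by (rule order_trans)
  then show ?thesis using that by (metis abs_ge_zero)
qed

lemma dual_of_sum:
  assumes S: "complex_vector.subspace S" and \<phi>: "\<phi> \<in> dual_of S"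
    and f: "\<And>j. j < n \<Longrightarrow> f j \<in> S"
  shows "\<phi> (\<Sum>j<(n::nat). c j *\<^sub>C f j) = (\<Sum>j<n. c j * \<phi> (f j))"
  using f
proof (induction n)
  case 0
  have "\<phi> (0 *\<^sub>C 0) = 0"
    using \<phi> complex_vector.subspace_0[OF S] unfolding dual_of_def by (metis (mono_tags, lifting) mem_Collect_eq mult_zero_left)
  then show ?case by simp
next
  case (Suc n)
  have "(\<Sum>j<n. c j *\<^sub>C f j) \<in> S" "c n *\<^sub>C f n \<in> S"
    using S Suc.prems by (auto intro!: complex_vector.subspace_sum complex_vector.subspace_scale)
  then show ?case using Suc \<phi> by (simp add: dual_of_def)
qed

lemma apply_bcontfun_sum:
  "apply_bcontfun (sum f I) t = (\<Sum>i\<in>I. apply_bcontfun (f i) t)"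
  by (induction I rule: infinite_finite_induct) (auto simp: plus_bcontfun.rep_eq)

text \<open>The bound does not depend on \<open>n\<close>, so a long sequence has members with small value under \<open>\<phi>\<close>.\<close>

lemma sum_dual_le:
  fixes f :: "nat \<Rightarrow> ('w::topological_space \<Rightarrow>\<^sub>C 'x::complex_normed_vector)"
  assumes S: "complex_vector.subspace S" and \<phi>: "\<phi> \<in> dual_of S"
    and K: "K \<ge> 0" "\<And>x. x \<in> S \<Longrightarrow> cmod (\<phi> x) \<le> K * norm x"
    and f: "\<And>j. j < n \<Longrightarrow> f j \<in> S"
    and C: "\<And>t. (\<Sum>j<n. norm (apply_bcontfun (f j) t)) \<le> C"
  shows "(\<Sum>j<n. cmod (\<phi> (f j))) \<le> K * C"
proof -
  \<comment> \<open>The factors \<open>c j\<close> rotate each \<open>\<phi> (f j)\<close> to its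
    modulus, so the sum becomes the value of \<open>\<phi>\<close> at the single function
    \<open>?g\<close>, whose norm is bounded pointwise by \<open>C\<close>.\<close>
  define c where "c j = cnj (sgn (\<phi> (f j)))" for j
  have c: "cmod (c j) \<le> 1" for j by (simp add: c_def norm_sgn)
  have c\<phi>: "c j * \<phi> (f j) = of_real (cmod (\<phi> (f j)))" for j
    by (cases "\<phi> (f j) = 0")
      (simp_all add: c_def sgn_div_norm scaleR_conv_of_real complex_norm_square[symmetric]
        field_simps power2_eq_square)
  let ?g = "\<Sum>j<n. c j *\<^sub>C f j"
  have "norm ?g \<le> C"
  proof (rule norm_bound)
    fix t
    have "norm (apply_bcontfun ?g t) \<le> (\<Sum>j<n. norm (c j *\<^sub>C apply_bcontfun (f j) t))"
      unfolding apply_bcontfun_sum apply_scaleC_bcontfun by (rule norm_sum)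
    also have "\<dots> \<le> (\<Sum>j<n. norm (apply_bcontfun (f j) t))"
      using c by (intro sum_mono) (simp add: norm_scaleC mult_left_le_one_le)
    also have "\<dots> \<le> C" by (rule C)
    finally show "norm (apply_bcontfun ?g t) \<le> C" .
  qed
  moreover have "?g \<in> S"
    using S f by (auto intro!: complex_vector.subspace_sum complex_vector.subspace_scale)
  ultimately have "cmod (\<phi> ?g) \<le> K * C" using K by (meson mult_left_mono order_trans)
  moreover have "\<phi> ?g = of_real (\<Sum>j<n. cmod (\<phi> (f j)))"
    by (simp add: dual_of_sum[OF S \<phi> f] c\<phi>)
  ultimately show ?thesis by (simp add: sum_nonneg del: of_real_sum)
qed

text \<open>Take \<open>h\<close> proportional to \<open>e\<^sup>k f\<close>, where \<open>f\<close> is bounded away from zero: by comparing growth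
  rates, multiplication by \<open>e\<close> must for some \<open>k\<close> scale the norm of \<open>e\<^sup>k f\<close> by almost \<open>norm e\<close>.\<close>

lemma almost_norming_multiplicand:
  assumes F: "function_space_over A F" and e: "e \<in> A" and \<eta>: "0 < \<eta>" "\<eta> < 1"
  obtains h where "h \<in> F" "norm h = 1" "norm (bcontfun_mult e h) \<ge> (1 - \<eta>) * norm e"
proof -
  have sub: "complex_vector.subspace F" using F by (simp add: function_space_over_def)
  \<comment> \<open>The constant 1 has the form \<open>\<phi> \<circ> f\<close> with
    \<open>f \<in> F\<close>; boundedness of \<open>\<phi>\<close> then keeps \<open>f\<close> away
    from zero.\<close>
  have "const_bcontfun 1 \<in> base_algebra F"
    using F by (auto simp: function_space_over_def function_algebra_def)
  then obtain f \<phi> where f: "f \<in> F" "\<phi> \<in> dual_of UNIV"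
      "apply_bcontfun (const_bcontfun 1) = \<phi> \<circ> apply_bcontfun f"
    by (auto simp: base_algebra_def)
  obtain K where K: "K \<ge> 0" "\<And>x. cmod (\<phi> x) \<le> K * norm x" using dual_of_bound[OF f(2)] by auto
  have \<phi>f: "\<phi> (apply_bcontfun f t) = 1" for t using fun_cong[OF f(3), of t] by simp
  have Kf: "1 \<le> K * norm (apply_bcontfun f t)" for t
    using K(2)[of "apply_bcontfun f t"] by (simp add: \<phi>f)
  define c where "c = 1 / (K + 1)"
  have c: "c > 0" using K(1) by (simp add: c_def)
  have cf: "c \<le> norm (apply_bcontfun f t)" for t
  proof -
    have "1 \<le> norm (apply_bcontfun f t) * (K + 1)"
      unfolding distrib_left mult.commute[of _ K] using Kf[of t] norm_ge_zero[of "apply_bcontfun f t"]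
      by linarith
    then show ?thesis using K(1) by (simp add: c_def pos_divide_le_eq)
  qed
  define E where "E k = (bcontfun_mult e ^^ k) f" for k
  have E: "E k \<in> F" "apply_bcontfun (E k) t = apply_bcontfun e t ^ k *\<^sub>C apply_bcontfun f t" for k t
    by (induction k) (use F e f in \<open>auto simp: E_def function_space_over_def scaleC_scaleC scaleC_one\<close>)
  have nE: "norm (apply_bcontfun e t) ^ k * c \<le> norm (E k)" for k t
    using norm_bounded[of "E k" t] mult_left_mono[OF cf[of t], of "norm (apply_bcontfun e t) ^ k"]
    by (simp add: E norm_scaleC norm_power)
  show ?thesis
  proof (cases "\<exists>k. E k \<noteq> 0 \<and> norm (E (Suc k)) \<ge> (1 - \<eta>) * norm e * norm (E k)")
    case True
    then obtain k where k: "E k \<noteq> 0" "norm (E (Suc k)) \<ge> (1 - \<eta>) * norm e * norm (E k)" by blast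
    define h where "h = of_real (1 / norm (E k)) *\<^sub>C E k"
    have "bcontfun_mult e h = of_real (1 / norm (E k)) *\<^sub>C E (Suc k)"
      by (rule bcontfun_eqI) (simp add: h_def E_def scaleC_scaleC mult.commute)
    then have "norm (bcontfun_mult e h) = norm (E (Suc k)) / norm (E k)"
      by (simp add: norm_scaleC norm_divide)
    then have "norm (bcontfun_mult e h) \<ge> (1 - \<eta>) * norm e"
      using k by (simp add: pos_le_divide_eq)
    moreover have "h \<in> F" using sub E(1) unfolding h_def by (rule complex_vector.subspace_scale)
    moreover have "norm h = 1" using k(1) by (simp add: h_def norm_scaleC norm_divide)
    ultimately show ?thesis using that by blast
  next
    case False
    \<comment> \<open>Otherwise \<open>norm (E k)\<close> is at most
      \<open>((1 - \<eta>) * norm e) ^ k * norm f\<close>. At a point where the modulus of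
      \<open>e\<close> exceeds \<open>(1 - \<eta> / 2) * norm e\<close> it is at least the
      \<open>k\<close>-th power of that times \<open>c\<close>. The ratio \<open>r < 1\<close> of
      the two rates rules this out for large \<open>k\<close>.\<close>
    have step: "norm (E (Suc k)) \<le> (1 - \<eta>) * norm e * norm (E k)" for k
    proof (cases "E k = 0")
      case True
      then have "E (Suc k) = bcontfun_mult e 0" by (simp add: E_def)
      also have "\<dots> = 0" by (rule bcontfun_eqI) simp
      finally show ?thesis using True by simp
    qed (use False in force)
    \<comment> \<open>For \<open>e = 0\<close> the index \<open>k = 0\<close> already belongs to the
      first case, since \<open>E 0 = f\<close> is nonzero.\<close>
    have "e \<noteq> 0"
    proof
      assume "e = 0"
      moreover have "E 0 \<noteq> 0" using nE[of undefined 0] c by auto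
      ultimately show False using False by fastforce
    qed
    have geo: "norm (E k) \<le> ((1 - \<eta>) * norm e) ^ k * norm f" for k
    proof (induction k)
      case (Suc k)
      have "norm (E (Suc k)) \<le> (1 - \<eta>) * norm e * norm (E k)" by (rule step)
      also have "\<dots> \<le> (1 - \<eta>) * norm e * (((1 - \<eta>) * norm e) ^ k * norm f)"
        using Suc \<eta> by (intro mult_left_mono mult_nonneg_nonneg) auto
      finally show ?case by (simp add: mult.assoc)
    qed (simp add: E_def)
    have "(1 - \<eta> / 2) * norm e < norm e" using \<eta> \<open>e \<noteq> 0\<close> by (simp add: algebra_simps)
    then obtain t where t: "(1 - \<eta> / 2) * norm e < cmod (apply_bcontfun e t)"
      using bcontfun_norm_gt by blast
    define r where "r = (1 - \<eta>) / (1 - \<eta> / 2)"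
    have r: "0 < r" "r < 1" using \<eta> by (auto simp: r_def field_simps)
    obtain k where k: "r ^ k < c / (norm f + 1)"
      using real_arch_pow_inv[OF _ r(2)] c by (metis add_nonneg_pos divide_pos_pos norm_ge_zero zero_less_one)
    have pos: "0 < ((1 - \<eta> / 2) * norm e) ^ k" using \<eta> \<open>e \<noteq> 0\<close> by simp
    have "((1 - \<eta> / 2) * norm e) ^ k * c \<le> cmod (apply_bcontfun e t) ^ k * c"
      using t c \<eta> by (intro mult_right_mono power_mono) auto
    also have "\<dots> \<le> ((1 - \<eta>) * norm e) ^ k * norm f" using nE geo by (rule order_trans)
    also have "\<dots> = ((1 - \<eta> / 2) * norm e) ^ k * (r ^ k * norm f)"
      using \<eta> by (simp add: r_def power_mult_distrib power_divide)
    finally have "c \<le> r ^ k * norm f" using pos by (simp add: mult_le_cancel_left_pos)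
    also have "\<dots> \<le> r ^ k * (norm f + 1)" using r by (intro mult_left_mono) auto
    also have "\<dots> < c" using k by (simp add: pos_less_divide_eq add_nonneg_pos)
    finally show ?thesis by simp
  qed
qed

section \<open>Almost units that are weakly small\<close>

text \<open>At most one \<open>S j\<close> contains \<open>t\<close>, and it accounts for
  \<open>B\<close>; the tails are at most \<open>1 / n\<close> each and add up to at most 1,
  whatever \<open>n\<close> is.\<close>

lemma sum_almost_disjoint_le:
  fixes a :: "nat \<Rightarrow> 'w \<Rightarrow> real"
  assumes "disjoint_family_on S {..<n}" "n > 0" "B \<ge> 0"
    and on: "\<And>j t. j < n \<Longrightarrow> a j t \<le> B"
    and off: "\<And>j t. j < n \<Longrightarrow> t \<notin> S j \<Longrightarrow> a j t \<le> 1 / n"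
  shows "(\<Sum>j<n. a j t) \<le> B + 1"
proof -
  have "(\<Sum>j<n. a j t) \<le> (\<Sum>j<n. (if t \<in> S j then B else 0) + 1 / n)"
    using assms by (intro sum_mono) (auto intro: order_trans add_increasing2)
  also have "\<dots> = (\<Sum>j<n. if t \<in> S j then B else 0) + 1"
    using \<open>n > 0\<close> by (simp add: sum.distrib)
  also have "(\<Sum>j<n. if t \<in> S j then B else 0) \<le> B"
  proof (cases "\<exists>i<n. t \<in> S i")
    case True
    then obtain i where i: "i < n" "t \<in> S i" by blast
    have "(t \<in> S j) = (j = i)" if "j < n" for j
      using assms(1) i that by (auto simp: disjoint_family_on_def)
    then have "(\<Sum>j<n. if t \<in> S j then B else 0) = (\<Sum>j<n. if j = i then B else 0)"
      by (intro sum.cong) auto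
    then show ?thesis using i by simp
  next
    case False
    then have "(\<Sum>j<n. if t \<in> S j then B else 0) = 0" by (intro sum.neutral) auto
    then show ?thesis using \<open>B \<ge> 0\<close> by simp
  qed
  finally show ?thesis by simp
qed

text \<open>An averaging argument: over \<open>n\<close> disjoint peak sets the values of all
  functionals add up to at most a constant \<open>B\<close> independent of \<open>n\<close>, so for
  \<open>n * \<epsilon> > B\<close> some index has total below \<open>\<epsilon>\<close>.\<close>

lemma weakly_small_almost_units:
  assumes F: "function_space_over A F" and inf: "\<not> finite_dimensional A"
    and \<Phi>: "finite \<Phi>" "\<Phi> \<subseteq> dual_of F" and f0: "f0 \<in> F" "norm f0 \<le> 1"
    and "\<epsilon> > 0" and \<eta>: "0 < \<eta>" "\<eta> < 1"
  obtains e h where "e \<in> A" "h \<in> F" "norm h = 1" "norm (bcontfun_mult e h) \<ge> 1 - 2 * \<eta>"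
    "\<And>t. cmod (apply_bcontfun e t) + cmod (1 - apply_bcontfun e t) \<le> 1 + \<eta>"
    "\<And>\<phi>. \<phi> \<in> \<Phi> \<Longrightarrow> cmod (\<phi> (bcontfun_mult e f0)) + cmod (\<phi> (bcontfun_mult e h)) < \<epsilon>"
proof -
  have A: "function_algebra A" and sub: "complex_vector.subspace F"
    and mult: "\<And>f g. f \<in> A \<Longrightarrow> g \<in> F \<Longrightarrow> bcontfun_mult f g \<in> F"
    using F by (auto simp: function_space_over_def)
  have "\<exists>K. \<forall>\<phi>\<in>\<Phi>. K \<phi> \<ge> 0 \<and> (\<forall>x\<in>F. cmod (\<phi> x) \<le> K \<phi> * norm x)"
    using \<Phi>(2) by (intro bchoice ballI) (meson dual_of_bound subsetD)
  then obtain K where K: "\<And>\<phi>. \<phi> \<in> \<Phi> \<Longrightarrow> K \<phi> \<ge> 0"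
      "\<And>\<phi> x. \<phi> \<in> \<Phi> \<Longrightarrow> x \<in> F \<Longrightarrow> cmod (\<phi> x) \<le> K \<phi> * norm x" by blast
  \<comment> \<open>The 3 is 2 + 1 from \<open>sum_almost_disjoint_le\<close>, as each
    \<open>e i\<close> has modulus at most 2; it occurs once for \<open>f0\<close> and once for the
    \<open>h i\<close>.\<close>
  define B where "B = (\<Sum>\<phi>\<in>\<Phi>. K \<phi> * 3 + K \<phi> * 3)"
  obtain n0 where n0: "B / \<epsilon> < real n0" using reals_Archimedean2 by blast
  define n where "n = Suc n0"
  have n: "n > 0" "B < n * \<epsilon>" using n0 \<open>\<epsilon> > 0\<close> by (auto simp: n_def field_simps)
  obtain S where S: "disjoint_family_on S {..<n}" "\<And>i. i < n \<Longrightarrow> peak_set A (S i)"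
    using disjoint_peak_sets[OF A inf] by metis
  \<comment> \<open>\<open>\<delta> \<le> \<eta>\<close> keeps each \<open>norm (e i)\<close> at
    least \<open>1 - \<eta>\<close>, and \<open>\<delta> \<le> 1 / n\<close> makes the tails off the
    peak sets summable to 1.\<close>
  define \<delta> where "\<delta> = min \<eta> (1 / n)"
  have \<delta>: "\<delta> > 0" "\<delta> \<le> \<eta>" "\<delta> \<le> 1 / n" using \<eta> n by (auto simp: \<delta>_def)
  have "\<exists>e h. i < n \<longrightarrow> e \<in> A \<and> norm e \<ge> 1 - \<delta> \<and> (\<forall>t. t \<notin> S i \<longrightarrow> cmod (apply_bcontfun e t) \<le> \<delta>)
      \<and> (\<forall>t. cmod (apply_bcontfun e t) + cmod (1 - apply_bcontfun e t) \<le> 1 + \<delta>)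
      \<and> h \<in> F \<and> norm h = 1 \<and> norm (bcontfun_mult e h) \<ge> (1 - \<eta>) * norm e" for i
  proof (cases "i < n")
    case True
    show ?thesis
      by (rule peak_function[OF A S(2)[OF True] \<delta>(1)], rule almost_norming_multiplicand[OF F _ \<eta>])
        blast+
  qed simp
  then obtain e h where "\<And>i. i < n \<longrightarrow> e i \<in> A \<and> norm (e i) \<ge> 1 - \<delta>
      \<and> (\<forall>t. t \<notin> S i \<longrightarrow> cmod (apply_bcontfun (e i) t) \<le> \<delta>)
      \<and> (\<forall>t. cmod (apply_bcontfun (e i) t) + cmod (1 - apply_bcontfun (e i) t) \<le> 1 + \<delta>)
      \<and> h i \<in> F \<and> norm (h i) = 1 \<and> norm (bcontfun_mult (e i) (h i)) \<ge> (1 - \<eta>) * norm (e i)"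
    by metis
  then have e: "\<And>i. i < n \<Longrightarrow> e i \<in> A" "\<And>i. i < n \<Longrightarrow> norm (e i) \<ge> 1 - \<delta>"
      "\<And>i t. i < n \<Longrightarrow> t \<notin> S i \<Longrightarrow> cmod (apply_bcontfun (e i) t) \<le> \<delta>"
      "\<And>i t. i < n \<Longrightarrow> cmod (apply_bcontfun (e i) t) + cmod (1 - apply_bcontfun (e i) t) \<le> 1 + \<delta>"
    and h: "\<And>i. i < n \<Longrightarrow> h i \<in> F" "\<And>i. i < n \<Longrightarrow> norm (h i) = 1"
      "\<And>i. i < n \<Longrightarrow> norm (bcontfun_mult (e i) (h i)) \<ge> (1 - \<eta>) * norm (e i)"
    by blast+
  have e_le: "cmod (apply_bcontfun (e i) t) \<le> 2" if "i < n" for i t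
    using e(4)[OF that, of t] \<delta>(2) \<eta>(2) norm_ge_zero[of "1 - apply_bcontfun (e i) t"] by linarith
  have e_sum: "(\<Sum>i<n. cmod (apply_bcontfun (e i) t)) \<le> 3" for t
    using sum_almost_disjoint_le[OF S(1) n(1), of 2 "\<lambda>i t. cmod (apply_bcontfun (e i) t)" t]
      e_le order_trans[OF e(3) \<delta>(3)] by simp
  have mult_sum: "(\<Sum>i<n. cmod (\<phi> (bcontfun_mult (e i) (g i)))) \<le> K \<phi> * 3"
    if "\<phi> \<in> \<Phi>" and g: "\<And>i. i < n \<Longrightarrow> g i \<in> F" "\<And>i. i < n \<Longrightarrow> norm (g i) \<le> 1" for \<phi> g
  proof (rule sum_dual_le[OF sub])
    show "\<phi> \<in> dual_of F" using that \<Phi> by blast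
    show "bcontfun_mult (e j) (g j) \<in> F" if "j < n" for j using mult e(1) g(1) that by blast
    fix t
    have "(\<Sum>j<n. norm (apply_bcontfun (bcontfun_mult (e j) (g j)) t))
        \<le> (\<Sum>i<n. cmod (apply_bcontfun (e i) t))"
    proof (rule sum_mono)
      fix j assume "j \<in> {..<n}"
      then have "norm (apply_bcontfun (g j) t) \<le> 1" using g(2)[of j] norm_bounded[of "g j" t] by simp
      then show "norm (apply_bcontfun (bcontfun_mult (e j) (g j)) t) \<le> cmod (apply_bcontfun (e j) t)"
        by (simp add: norm_scaleC mult_left_le)
    qed
    then show "(\<Sum>j<n. norm (apply_bcontfun (bcontfun_mult (e j) (g j)) t)) \<le> 3"
      using e_sum by (rule order_trans)
  qed (use K that in auto)
  define a where "a i = (\<Sum>\<phi>\<in>\<Phi>. cmod (\<phi> (bcontfun_mult (e i) f0)) + cmod (\<phi> (bcontfun_mult (e i) (h i))))" for i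
  have "(\<Sum>i<n. a i) = (\<Sum>\<phi>\<in>\<Phi>. (\<Sum>i<n. cmod (\<phi> (bcontfun_mult (e i) f0)))
      + (\<Sum>i<n. cmod (\<phi> (bcontfun_mult (e i) (h i)))))"
    unfolding a_def by (subst sum.swap) (simp add: sum.distrib)
  also have "\<dots> \<le> B"
    unfolding B_def by (intro sum_mono add_mono mult_sum) (use f0 h in auto)
  finally have "(\<Sum>i<n. a i) < (\<Sum>i<n. \<epsilon>)" using n(2) by simp
  then obtain i where i: "i < n" "a i < \<epsilon>"
    by (meson lessThan_iff not_le sum_mono)
  show ?thesis
  proof
    show "e i \<in> A" "h i \<in> F" "norm (h i) = 1" using e h i by auto
    have "(1 - \<eta>) * (1 - \<eta>) \<le> (1 - \<eta>) * norm (e i)"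
      using e(2)[OF i(1)] \<delta>(2) \<eta> by (intro mult_left_mono) auto
    moreover have "1 - 2 * \<eta> \<le> (1 - \<eta>) * (1 - \<eta>)" by (simp add: algebra_simps)
    ultimately show "norm (bcontfun_mult (e i) (h i)) \<ge> 1 - 2 * \<eta>" using h(3)[OF i(1)] by linarith
    show "cmod (apply_bcontfun (e i) t) + cmod (1 - apply_bcontfun (e i) t) \<le> 1 + \<eta>" for t
      using e(4)[OF i(1), of t] \<delta>(2) by linarith
    show "cmod (\<phi> (bcontfun_mult (e i) f0)) + cmod (\<phi> (bcontfun_mult (e i) (h i))) < \<epsilon>"
      if "\<phi> \<in> \<Phi>" for \<phi>
      using member_le_sum[OF that, of "\<lambda>\<phi>. cmod (\<phi> (bcontfun_mult (e i) f0)) + cmod (\<phi> (bcontfun_mult (e i) (h i)))"]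
        \<Phi>(1) i(2) by (simp add: a_def)
  qed
qed

section \<open>Almost diametral pairs in weakly open parts of the ball\<close>

theorem corollary4p9:
  fixes A :: "('w::t2_space \<Rightarrow>\<^sub>C complex) set"
    and F :: "('w \<Rightarrow>\<^sub>C 'x::complex_banach) set"
  assumes "\<exists>x::'x. x \<noteq> 0"
    and "function_space_over A F"
    and "\<not> finite_dimensional A"
  shows "diameter_two_property F"
  unfolding diameter_two_property_def
proof (intro allI impI antisym)
  fix W assume "openin (subtopology (weak_topology_of F) (F \<inter> cball 0 1)) W \<and> W \<noteq> {}"
  then obtain V where V: "openin (weak_topology_of F) V" "W = V \<inter> (F \<inter> cball 0 1)" and "W \<noteq> {}"
    unfolding openin_subtopology by blast
  then obtain f0 where "f0 \<in> W" by blast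
  then have f0: "f0 \<in> V" "f0 \<in> F" "norm f0 \<le> 1" using V(2) by auto
  have bdd: "bounded W" using V(2) bounded_cball bounded_subset by blast
  show "diameter W \<le> 2"
  proof (rule diameter_le)
    fix x y assume "x \<in> W" "y \<in> W"
    then show "norm (x - y) \<le> 2" using V(2) norm_triangle_ineq4[of x y] by auto
  qed simp
  have sub: "complex_vector.subspace F"
    and mult: "\<And>f g. f \<in> A \<Longrightarrow> g \<in> F \<Longrightarrow> bcontfun_mult f g \<in> F"
    using assms(2) by (auto simp: function_space_over_def)
  obtain \<Phi> \<epsilon> where \<Phi>: "finite \<Phi>" "\<Phi> \<subseteq> dual_of F" and "\<epsilon> > 0"
    and VI: "\<And>y. y \<in> F \<Longrightarrow> (\<And>\<phi>. \<phi> \<in> \<Phi> \<Longrightarrow> cmod (\<phi> y - \<phi> f0) < \<epsilon>) \<Longrightarrow> y \<in> V"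
    using weak_topology_of_neighbourhood[OF V(1) f0(1)] by blast
  \<comment> \<open>The summand 1 keeps \<open>M\<close> positive even if \<open>\<Phi>\<close> is
    empty, so that \<open>\<epsilon> / (2 * M)\<close> can bound \<open>\<eta>\<close>
    later.\<close>
  define M where "M = (\<Sum>\<phi>\<in>\<Phi>. cmod (\<phi> f0)) + 1"
  have M: "M \<ge> 1" by (simp add: M_def sum_nonneg)
  have \<phi>M: "cmod (\<phi> f0) \<le> M" if "\<phi> \<in> \<Phi>" for \<phi>
    using member_le_sum[OF that, of "\<lambda>\<phi>. cmod (\<phi> f0)"] \<Phi>(1) by (simp add: M_def)
  have large: "2 * (1 - 3 * \<eta>) \<le> diameter W" if \<eta>: "0 < \<eta>" "\<eta> < 1" "\<eta> * M \<le> \<epsilon> / 2" for \<eta>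
  proof -
    obtain e h where e: "e \<in> A" and h: "h \<in> F" "norm h = 1" "norm (bcontfun_mult e h) \<ge> 1 - 2 * \<eta>"
      and e_le: "\<And>t. cmod (apply_bcontfun e t) + cmod (1 - apply_bcontfun e t) \<le> 1 + \<eta>"
      and small: "\<And>\<phi>. \<phi> \<in> \<Phi> \<Longrightarrow> cmod (\<phi> (bcontfun_mult e f0)) + cmod (\<phi> (bcontfun_mult e h)) < \<epsilon> / 2"
      using weakly_small_almost_units[OF assms(2,3) \<Phi> f0(2,3) half_gt_zero[OF \<open>\<epsilon> > 0\<close>] \<eta>(1,2)]
      by blast
    define r where "r = 1 / (1 + \<eta>)"
    have r: "0 < r" "r \<le> 1" "r * (1 + \<eta>) = 1" using \<eta> by (auto simp: r_def)
    \<comment> \<open>This is \<open>(1 - e) f0 + u e h\<close>, shrunk by \<open>r\<close> to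
      absorb the bound \<open>1 + \<eta>\<close> on \<open>cmod e + cmod (1 - e)\<close>. It is used
      for \<open>u = 1\<close> and \<open>u = -1\<close>.\<close>
    define G where "G u = of_real r *\<^sub>C (f0 + ((-1) *\<^sub>C bcontfun_mult e f0 + u *\<^sub>C bcontfun_mult e h))"
      for u :: complex
    have ef: "bcontfun_mult e f0 \<in> F" and eh: "bcontfun_mult e h \<in> F" using mult e f0 h by auto
    have in_W: "G u \<in> W" if u: "cmod u = 1" for u
    proof -
      have "G u \<in> F" unfolding G_def
        using sub f0 ef eh by (intro complex_vector.subspace_scale complex_vector.subspace_add)
      moreover have "norm (G u) \<le> 1"
      proof (rule norm_bound)
        fix t
        have "apply_bcontfun (G u) t = of_real r *\<^sub>C ((1 - apply_bcontfun e t) *\<^sub>C apply_bcontfun f0 t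
            + (u * apply_bcontfun e t) *\<^sub>C apply_bcontfun h t)"
          by (simp add: G_def plus_bcontfun.rep_eq scaleC_scaleC complex_vector.scale_left_diff_distrib scaleC_one)
        then have "norm (apply_bcontfun (G u) t)
            \<le> r * (cmod (1 - apply_bcontfun e t) * norm (apply_bcontfun f0 t)
              + cmod (apply_bcontfun e t) * norm (apply_bcontfun h t))"
          using r(1) u norm_triangle_ineq[of "(1 - apply_bcontfun e t) *\<^sub>C apply_bcontfun f0 t"
              "(u * apply_bcontfun e t) *\<^sub>C apply_bcontfun h t"]
          by (simp add: norm_scaleC norm_mult)
        also have "\<dots> \<le> r * (cmod (1 - apply_bcontfun e t) * 1 + cmod (apply_bcontfun e t) * 1)"
          using r(1) f0(3) h(2) norm_bounded[of f0 t] norm_bounded[of h t]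
          by (intro mult_left_mono add_mono) auto
        also have "\<dots> \<le> r * (1 + \<eta>)" using r(1) e_le[of t] by (intro mult_left_mono) auto
        finally show "norm (apply_bcontfun (G u) t) \<le> 1" by (simp add: r(3))
      qed
      moreover have "G u \<in> V"
      proof (rule VI)
        show "G u \<in> F" by fact
        fix \<phi> assume \<phi>: "\<phi> \<in> \<Phi>"
        have lin: "\<phi> (x + y) = \<phi> x + \<phi> y" "\<phi> (c *\<^sub>C x) = c * \<phi> x" if "x \<in> F" "y \<in> F" for x y c
          using \<phi> \<Phi>(2) that by (auto simp: dual_of_def)
        have mem: "(-1) *\<^sub>C bcontfun_mult e f0 \<in> F" "u *\<^sub>C bcontfun_mult e h \<in> F"
          using sub ef eh complex_vector.subspace_scale by blast+
        have mem2: "(-1) *\<^sub>C bcontfun_mult e f0 + u *\<^sub>C bcontfun_mult e h \<in> F"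
          using sub mem by (rule complex_vector.subspace_add)
        have "f0 + ((-1) *\<^sub>C bcontfun_mult e f0 + u *\<^sub>C bcontfun_mult e h) \<in> F"
          using sub f0(2) mem2 by (rule complex_vector.subspace_add)
        then have "\<phi> (G u) = of_real r * (\<phi> f0 + (- \<phi> (bcontfun_mult e f0) + u * \<phi> (bcontfun_mult e h)))"
          unfolding G_def using lin(2)[OF _ f0(2)] lin(1)[OF f0(2) mem2] lin(1)[OF mem] lin(2)[OF ef ef, of "-1"]
            lin(2)[OF eh eh]
          by (simp del: complex_vector.scale_minus_left)
        \<comment> \<open>The first part is small by the choice of \<open>e\<close> and
          \<open>h\<close>. The second is the price of shrinking, at most \<open>\<eta> * M\<close>
          because \<open>1 - r = r * \<eta>\<close>.\<close>
        then have "\<phi> (G u) - \<phi> f0 = of_real r * (- \<phi> (bcontfun_mult e f0) + u * \<phi> (bcontfun_mult e h))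
            - of_real (1 - r) * \<phi> f0"
          by (simp add: algebra_simps)
        also have "cmod \<dots> \<le> r * (cmod (\<phi> (bcontfun_mult e f0)) + cmod (\<phi> (bcontfun_mult e h)))
            + (1 - r) * cmod (\<phi> f0)"
        proof -
          have "cmod (- \<phi> (bcontfun_mult e f0) + u * \<phi> (bcontfun_mult e h))
              \<le> cmod (\<phi> (bcontfun_mult e f0)) + cmod (\<phi> (bcontfun_mult e h))"
            using norm_triangle_ineq[of "- \<phi> (bcontfun_mult e f0)" "u * \<phi> (bcontfun_mult e h)"] u
            by (simp add: norm_mult)
          then have "cmod (of_real r * (- \<phi> (bcontfun_mult e f0) + u * \<phi> (bcontfun_mult e h)))
              \<le> r * (cmod (\<phi> (bcontfun_mult e f0)) + cmod (\<phi> (bcontfun_mult e h)))"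
            using r(1) unfolding norm_mult by (simp add: mult_left_mono)
          moreover have "cmod (of_real (1 - r) * \<phi> f0) = (1 - r) * cmod (\<phi> f0)"
            unfolding norm_mult norm_of_real using r(2) by simp
          ultimately show ?thesis
            by (intro order_trans[OF norm_triangle_ineq4]) linarith
        qed
        also have "\<dots> < \<epsilon> / 2 + \<epsilon> / 2"
        proof (rule add_less_le_mono)
          have "r * (cmod (\<phi> (bcontfun_mult e f0)) + cmod (\<phi> (bcontfun_mult e h)))
              \<le> cmod (\<phi> (bcontfun_mult e f0)) + cmod (\<phi> (bcontfun_mult e h))"
            using r by (intro mult_left_le_one_le) auto
          then show "r * (cmod (\<phi> (bcontfun_mult e f0)) + cmod (\<phi> (bcontfun_mult e h))) < \<epsilon> / 2"
            using small[OF \<phi>] by linarith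
          have "1 - r = r * \<eta>" using r(3) by (simp add: algebra_simps)
          then have "1 - r \<le> \<eta>" using r \<eta> by (simp add: mult_left_le_one_le)
          then have "(1 - r) * cmod (\<phi> f0) \<le> \<eta> * M"
            using \<phi>M[OF \<phi>] \<eta> by (intro mult_mono) auto
          then show "(1 - r) * cmod (\<phi> f0) \<le> \<epsilon> / 2" using \<eta>(3) by linarith
        qed
        finally show "cmod (\<phi> (G u) - \<phi> f0) < \<epsilon>" by simp
      qed
      ultimately show ?thesis using V(2) by simp
    qed
    \<comment> \<open>The contributions of \<open>f0\<close> cancel, and
      \<open>norm (bcontfun_mult e h) \<ge> 1 - 2 * \<eta>\<close> together with the factor
      \<open>r\<close> gives the \<open>1 - 3 * \<eta>\<close> of the claim.\<close>
    have "G 1 - G (-1) = of_real (2 * r) *\<^sub>C bcontfun_mult e h"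
    proof -
      have "G 1 - G (-1) = of_real r *\<^sub>C (bcontfun_mult e h + bcontfun_mult e h)"
        unfolding G_def complex_vector.scale_right_diff_distrib[symmetric] by (simp add: scaleC_one)
      also have "\<dots> = of_real (r + r) *\<^sub>C bcontfun_mult e h"
        by (simp only: scaleC_add_right scaleC_add_left of_real_add)
      finally show ?thesis by simp
    qed
    then have "dist (G 1) (G (-1)) = 2 * r * norm (bcontfun_mult e h)"
      using r(1) by (simp add: dist_norm norm_scaleC norm_mult)
    moreover have "dist (G 1) (G (-1)) \<le> diameter W"
      by (intro diameter_bounded_bound[OF bdd] in_W) auto
    moreover have "1 - 3 * \<eta> \<le> r * norm (bcontfun_mult e h)"
    proof -
      have "(1 - 3 * \<eta>) * (1 + \<eta>) \<le> 1 - 2 * \<eta>" by (simp add: algebra_simps)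
      then have "(1 - 3 * \<eta>) * (1 + \<eta>) \<le> norm (bcontfun_mult e h)" using h(3) by linarith
      then show ?thesis using \<eta>(1) by (simp add: r_def pos_le_divide_eq)
    qed
    ultimately show ?thesis by (simp add: mult.assoc)
  qed
  show "2 \<le> diameter W"
  proof (rule field_le_epsilon)
    fix d :: real assume "d > 0"
    \<comment> \<open>The three bounds give \<open>\<eta> < 1\<close>, a loss
      \<open>6 * \<eta> \<le> d\<close> in the diameter, and
      \<open>\<eta> * M \<le> \<epsilon> / 2\<close>.\<close>
    define \<eta> where "\<eta> = min (min (1 / 2) (d / 6)) (\<epsilon> / (2 * M))"
    have "0 < \<eta>" using \<open>d > 0\<close> \<open>\<epsilon> > 0\<close> M by (simp add: \<eta>_def)
    moreover have "\<eta> \<le> 1 / 2" "\<eta> \<le> d / 6" "\<eta> \<le> \<epsilon> / (2 * M)"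
      unfolding \<eta>_def by (rule min.cobounded1 min.cobounded2 min.coboundedI1)+
    moreover from this have "\<eta> * M \<le> \<epsilon> / 2" using M by (simp add: field_simps)
    ultimately show "2 \<le> diameter W + d" using large[of \<eta>] by simp
  qed
qed

end
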